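(* Let $N\ge 3$ and let $f$ satisfy the standing assumptions given in the context. Assume that $u(r,\alpha)$ is stable for all $\alpha>0$. Then there exists a singular radial solution $u^*$ of $\Delta u+f(u)=0$ in $\mathbb{R}^N$ satisfying $$u^*(r)>0\ \text{ for all } r>0,\qquad f'(u^*(|\cdot|))\in L^1_{\rm loc}(\mathbb{R}^N),$$ and $$\int_{\mathbb{R}^N}\bigl(|\nabla\phi|^2-f'(u^*(|x|))\phi^2\bigr)\,dx\ge 0\quad\text{for any }\phi\in C^1_0(\mathbb{R}^N).$$ In particular, $u^*$ is obtained as the increasing limit of $u(\cdot,\alpha)$ as $\alpha\to\infty$, i.e. $u(r,\alpha)$ is increasing in $\alpha$ and $u^*(r)=\lim_{\alpha\to\infty}u(r,\alpha)$ for each $r>0$.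
   Context: $N\ge 3$ is an integer. Standing assumptions on $f:\mathbb{R}\to\mathbb{R}$: $f\in C^2(\mathbb{R}\setminus\{0\})\cap C^1(\mathbb{R})$; $f$ is odd (so $f(0)=0$); and for all $u>0$, $f(u)>0$, $f'(u)>0$, $f''(u)>0$ and $F(u):=\int_u^\infty \frac{ds}{f(s)}<\infty$. For $\alpha>0$, $u(r,\alpha)$ denotes the unique solution of $u''+\frac{N-1}{r}u'+f(u)=0$ for $r>0$, $u(0)=\alpha$, $u'(0)=0$. $C^1_0(\mathbb{R}^N)$ denotes $C^1$ functions with compact support. A solution $u\in C^2(\mathbb{R}^N)$ of $\Delta u+f(u)=0$ in $\mathbb{R}^N$ is called stable if $\int_{\mathbb{R}^N}(|\nabla\phi|^2-f'(u)\phi^2)\,dx\ge 0$ for every $\phi\in C^1_0(\mathbb{R}^N)$. We say $u(r,\alpha)$ is stable if $x\mapsto u(|x|,\alpha)$ is. A singular radial solution of $\Delta u+f(u)=0$ in $\mathbb{R}^N$ is a function $u^*\in C^2(0,\infty)$ satisfying $(u^* )''+\frac{N-1}{r}(u^* )'+f(u^* )=0$ for $r>0$ and $u^*(r)\to\infty$ as $r\to 0$. *)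

theory Defs
  imports "HOL-Analysis.Analysis"
begin

(* Only used for open S, where the two-sided deriv is the right notion. *)
definition C2_on :: "real set \<Rightarrow> (real \<Rightarrow> real) \<Rightarrow> bool" where
  "C2_on S v \<longleftrightarrow>
     (\<forall>x\<in>S. v differentiable (at x)) \<and>
     (\<forall>x\<in>S. deriv v differentiable (at x)) \<and>
     continuous_on S (deriv (deriv v))"

definition standing_assumptions :: "(real \<Rightarrow> real) \<Rightarrow> bool" where
  "standing_assumptions f \<longleftrightarrow>
     C2_on (- {0}) f \<and>
     (\<forall>x. f differentiable (at x)) \<and> continuous_on UNIV (deriv f) \<and>
     (\<forall>x. f (- x) = - f x) \<and>
     (\<forall>u>0. f u > 0 \<and> deriv f u > 0 \<and> deriv (deriv f) u > 0 \<and>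
            (\<integral>\<^sup>+ s\<in>{u..}. ennreal (1 / f s) \<partial>lborel) < \<infinity>)"

definition radial_solution :: "nat \<Rightarrow> (real \<Rightarrow> real) \<Rightarrow> (real \<Rightarrow> real) \<Rightarrow> bool" where
  "radial_solution N f v \<longleftrightarrow>
     C2_on {0<..} v \<and>
     (\<forall>r>0. deriv (deriv v) r + (real N - 1) / r * deriv v r + f (v r) = 0)"

(* A function on [0,\<infinity>) is represented by a total function whose values at negative
   arguments are irrelevant; the derivative at 0 is therefore one-sided. *)
definition radial_ivp_solution ::
    "nat \<Rightarrow> (real \<Rightarrow> real) \<Rightarrow> real \<Rightarrow> (real \<Rightarrow> real) \<Rightarrow> bool" where
  "radial_ivp_solution N f \<alpha> v \<longleftrightarrow>
     radial_solution N f v \<and> v 0 = \<alpha> \<and> (v has_real_derivative 0) (at 0 within {0..})"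

definition singular_radial_solution :: "nat \<Rightarrow> (real \<Rightarrow> real) \<Rightarrow> (real \<Rightarrow> real) \<Rightarrow> bool" where
  "singular_radial_solution N f v \<longleftrightarrow>
     radial_solution N f v \<and> filterlim v at_top (at_right 0)"

definition grad :: "('a::euclidean_space \<Rightarrow> real) \<Rightarrow> 'a \<Rightarrow> 'a" where
  "grad \<phi> x = (\<Sum>b\<in>Basis. frechet_derivative \<phi> (at x) b *\<^sub>R b)"

definition C1 :: "('a::euclidean_space \<Rightarrow> real) \<Rightarrow> bool" where
  "C1 \<phi> \<longleftrightarrow> (\<forall>x. \<phi> differentiable (at x)) \<and> continuous_on UNIV (grad \<phi>)"

definition C1_0 :: "('a::euclidean_space \<Rightarrow> real) set" where
  "C1_0 = {\<phi>. C1 \<phi> \<and> compact (closure {x. \<phi> x \<noteq> 0})}"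

definition C2 :: "('a::euclidean_space \<Rightarrow> real) \<Rightarrow> bool" where
  "C2 U \<longleftrightarrow> C1 U \<and> (\<forall>b\<in>Basis. C1 (\<lambda>x. grad U x \<bullet> b))"

definition laplacian :: "('a::euclidean_space \<Rightarrow> real) \<Rightarrow> 'a \<Rightarrow> real" where
  "laplacian U x = (\<Sum>b\<in>Basis. grad (\<lambda>y. grad U y \<bullet> b) x \<bullet> b)"

definition stability_form ::
    "(real \<Rightarrow> real) \<Rightarrow> ('a::euclidean_space \<Rightarrow> real) \<Rightarrow> ('a \<Rightarrow> real) \<Rightarrow> real" where
  "stability_form f U \<phi> =
     (\<integral>x. ((norm (grad \<phi> x))\<^sup>2 - deriv f (U x) * (\<phi> x)\<^sup>2) \<partial>lborel)"

definition stable_solution :: "(real \<Rightarrow> real) \<Rightarrow> ('a::euclidean_space \<Rightarrow> real) \<Rightarrow> bool" where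
  "stable_solution f U \<longleftrightarrow>
     C2 U \<and> (\<forall>x. laplacian U x + f (U x) = 0) \<and>
     (\<forall>\<phi>\<in>C1_0. stability_form f U \<phi> \<ge> 0)"

definition L1_loc :: "('a::euclidean_space \<Rightarrow> real) set" where
  "L1_loc = {g. \<forall>K. compact K \<longrightarrow> set_integrable lborel K g}"

end

theory Submission
  imports Defs
begin

text \<open>
  If a solution u(.,\<beta>) touched a smaller nonnegative solution z (either 0 or u(.,\<alpha>) with
  \<alpha> < \<beta>) for the first time at radius R, the difference w of the two, cut off at R, would be a test
  function with \<integral>|\<nabla>w|^2 = \<integral>(f(u) - f(z))w < \<integral>f'(u)w^2 by strict convexity,
  against the stability of u(.,\<beta>). Hence all solutions are positive and increase with \<alpha>.
  Since u'/f(u) \<le> -r/N and 1/f is integrable at infinity, u(r,\<alpha>) is bounded in \<alpha> for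
  each r > 0. The derivatives u'(r,\<alpha>) are decreasing in \<alpha> and bounded, and bounds on higher
  derivatives away from the origin show that the pointwise limit solves the equation. Integrability of
  f'(u*) and stability of u* follow from Fatou's lemma.
\<close>

text \<open>Stability quantifies over C1 test functions on the whole space, while the comparison
  takes place on an interval [0,R]; radial test functions turn the form into a one-dimensional
  integral with weight r^(N-1), up to a positive constant. The estimates all come from the flux
  r^(N-1) u', which starts at 0 and has derivative -r^(N-1) f(u). It makes u decreasing, hence f(u)
  decreasing, and integrating the flux with f(u) bounded below by its value at r gives the
  inequality for u'/f(u). For a primitive G of 1/f it says that G(u(r)) + r^2/(2N) is nonincreasing.
  As G is bounded, G(u(r)) stays below sup G by at least r^2/(2N), whatever the central value.
  Monotonicity in \<alpha> makes both u and u' converge at each r > 0. To identify the limits it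
  remains to differentiate under a pointwise limit, which takes a bound on u'' for the pair (u, u')
  and on u''' for the pair (u', u''). Convergence is known only away from the origin, a null set for
  Fatou's lemma.\<close>

section \<open>Radial integration, radial test functions and the one-dimensional stability
  form\<close>

text \<open>Polar coordinates for radial integrands. Half-lines {..b} form an intersection-stable
  generator, and on them both sides give the ball volume: r^N has derivative N r^(N-1).\<close>

lemma distr_norm_lborel:
  "distr (lborel :: 'a::euclidean_space measure) borel norm =
     density lborel (\<lambda>r. ennreal (indicator {0..} r * (real DIM('a) * unit_ball_vol DIM('a) * r ^ (DIM('a) - 1))))"
    (is "?M = ?D")
proof (rule measure_eqI_generator_eq[where E = "range atMost" and A = "\<lambda>i::nat. {..real i}" and \<Omega> = UNIV])
  let ?N = "DIM('a)"
  have sphere: "emeasure ?M {..b} = ennreal (unit_ball_vol ?N * (max b 0) ^ ?N)" for b :: real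
  proof -
    have "norm -` {..b} \<inter> space (lborel :: 'a measure) = cball 0 b" by (auto simp: dist_norm)
    then show ?thesis
      by (cases "b \<ge> 0") (auto simp: emeasure_distr emeasure_cball cball_empty)
  qed
  have dens: "emeasure ?D {..b} = ennreal (unit_ball_vol ?N * (max b 0) ^ ?N)" for b :: real
  proof -
    have "emeasure ?D {..b} = (\<integral>\<^sup>+r. ennreal (indicator {0..} r * (real ?N * unit_ball_vol ?N * r ^ (?N - 1))) * indicator {..b} r \<partial>lborel)"
      by (subst emeasure_density) auto
    also have "\<dots> = (\<integral>\<^sup>+r. ennreal (unit_ball_vol ?N * (real ?N * r ^ (?N - 1))) * indicator {0..max b 0} r \<partial>lborel)"
      by (intro nn_integral_cong_AE AE_mp[OF AE_lborel_singleton[of 0] AE_I2])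
         (auto simp: indicator_def mult_ac)
    also have "\<dots> = ennreal (unit_ball_vol ?N * (max b 0) ^ ?N - unit_ball_vol ?N * 0 ^ ?N)"
      by (rule nn_integral_FTC_Icc) (auto intro!: derivative_eq_intros)
    finally show ?thesis by simp
  qed
  show "Int_stable (range (atMost :: real \<Rightarrow> real set))" by (auto simp: Int_stable_def)
  show "emeasure ?M X = emeasure ?D X" if "X \<in> range atMost" for X
    using that sphere dens by auto
  show "sets ?M = sigma_sets UNIV (range atMost)"
    by (simp, subst borel_eq_atMost) auto
  show "sets ?D = sigma_sets UNIV (range atMost)"
    by (simp, subst borel_eq_atMost) auto
  show "(\<Union>i::nat. {..real i}) = UNIV" using real_arch_simple by auto
  show "emeasure ?M {..real i} \<noteq> \<infinity>" for i by (simp add: sphere)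
qed auto

text \<open>Nothing is assumed about \<open>g\<close> at negative arguments, so it is first
  multiplied by the indicator of {0..R}, which makes it Borel measurable without changing g (norm
  x).\<close>

lemma integral_radial:
  fixes g :: "real \<Rightarrow> real"
  assumes "continuous_on {0..R} g" and "\<And>r. r > R \<Longrightarrow> g r = 0"
  shows "(\<integral>x. g (norm x) \<partial>(lborel :: 'a::euclidean_space measure)) =
         real DIM('a) * unit_ball_vol DIM('a) * integral {0..R} (\<lambda>r. r ^ (DIM('a) - 1) * g r)"
proof -
  let ?c = "real DIM('a) * unit_ball_vol DIM('a)" and ?N = "DIM('a)"
  let ?g = "\<lambda>r. indicator {0..R} r * g r"
  have meas: "?g \<in> borel_measurable borel"
    using borel_measurable_continuous_on_indicator[of "{0..R}" g] assms by simp
  have int: "set_integrable lborel {0..R} (\<lambda>r. r ^ (?N - 1) * g r)"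
    by (rule borel_integrable_atLeastAtMost') (intro continuous_intros assms)
  have "(\<integral>x. g (norm x) \<partial>(lborel :: 'a measure)) = (\<integral>x. ?g (norm x) \<partial>(lborel :: 'a measure))"
    using assms(2) by (intro Bochner_Integration.integral_cong) (auto simp: indicator_def not_le)
  also have "\<dots> = (\<integral>r. ?g r \<partial>(distr (lborel :: 'a measure) borel norm))"
    by (subst integral_distr) (use meas in auto)
  also have "\<dots> = (\<integral>r. (indicator {0..} r * (?c * r ^ (?N - 1))) * ?g r \<partial>lborel)"
    unfolding distr_norm_lborel
    by (subst integral_density) (use meas in \<open>auto simp: indicator_def\<close>)
  also have "\<dots> = (\<integral>r. ?c * (indicator {0..R} r *\<^sub>R (r ^ (?N - 1) * g r)) \<partial>lborel)"
    by (intro Bochner_Integration.integral_cong) (auto simp: indicator_def)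
  also have "\<dots> = ?c * (LINT r:{0..R}|lborel. r ^ (?N - 1) * g r)"
    unfolding set_lebesgue_integral_def by (rule Bochner_Integration.integral_mult_right_zero)
  also have "\<dots> = ?c * integral {0..R} (\<lambda>r. r ^ (?N - 1) * g r)"
    using int by (simp add: set_borel_integral_eq_integral)
  finally show ?thesis .
qed

lemma grad_unique:
  assumes "(\<phi> has_derivative (\<lambda>h. G \<bullet> h)) (at x)"
  shows "grad \<phi> x = G"
  unfolding grad_def frechet_derivative_at[OF assms, symmetric]
  by (rule euclidean_representation)

text \<open>Away from the origin this is the chain rule. At the origin, where the norm has no
  derivative, the vanishing one-sided derivative of \<eta> makes the difference quotient tend to 0,
  and sgn 0 = 0 lets one formula cover both cases.\<close>

lemma grad_radial:
  fixes \<eta> \<eta>' :: "real \<Rightarrow> real" and x :: "'a::euclidean_space"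
  assumes d: "\<And>r. r > 0 \<Longrightarrow> (\<eta> has_real_derivative \<eta>' r) (at r)"
    and d0: "(\<eta> has_real_derivative 0) (at 0 within {0..})" and z: "\<eta>' 0 = 0"
  shows "((\<lambda>x. \<eta> (norm x)) has_derivative (\<lambda>h. (\<eta>' (norm x) *\<^sub>R sgn x) \<bullet> h)) (at x)"
proof (cases "x = 0")
  case True
  have "(\<eta> has_derivative (\<lambda>h. h * 0)) (at 0 within {0..})"
    using d0 by (simp add: has_field_derivative_def lambda_zero)
  then have *: "((\<lambda>y. norm (\<eta> y - \<eta> 0) / norm (y - 0)) \<longlongrightarrow> 0) (at 0 within {0..})"
    by (simp add: has_derivative_iff_norm)
  have "filterlim norm (at 0 within {0..}) (at (0::'a))"
    by (auto simp: filterlim_at eventually_at_filter intro!: tendsto_eq_intros)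
  from filterlim_compose[OF * this]
  have "((\<lambda>y::'a. norm (\<eta> (norm y) - \<eta> 0) / norm y) \<longlongrightarrow> 0) (at 0)" by simp
  then show ?thesis
    by (simp add: True has_derivative_iff_norm z)
next
  case False
  then have "((\<lambda>x. \<eta> (norm x)) has_derivative (\<lambda>h. (sgn x \<bullet> h) * \<eta>' (norm x))) (at x)"
    using d[of "norm x"] has_derivative_norm[of x]
    by (intro has_derivative_eq_rhs[OF has_derivative_compose[where g = \<eta> and f = norm and g' = "(*) (\<eta>' (norm x))"]])
       (auto simp: has_field_derivative_def mult.commute inner_commute)
  then show ?thesis by (simp add: mult.commute)
qed

text \<open>The jump of sgn at the origin is absorbed by the factor \<eta>' (norm x), which tends to
  \<eta>' 0 = 0 there.\<close>

lemma radial_in_C1_0: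
  fixes \<eta> \<eta>' :: "real \<Rightarrow> real"
  assumes d: "\<And>r. r > 0 \<Longrightarrow> (\<eta> has_real_derivative \<eta>' r) (at r)"
    and d0: "(\<eta> has_real_derivative 0) (at 0 within {0..})" and z: "\<eta>' 0 = 0"
    and c: "continuous_on {0..} \<eta>'" and supp: "\<And>r. r > R \<Longrightarrow> \<eta> r = 0"
  shows "(\<lambda>x::'a::euclidean_space. \<eta> (norm x)) \<in> C1_0"
    and "norm (grad (\<lambda>x::'a. \<eta> (norm x)) x) = \<bar>\<eta>' (norm x)\<bar>"
proof -
  note D = grad_radial[OF d d0 z, where ?'a = 'a]
  have G: "grad (\<lambda>x::'a. \<eta> (norm x)) = (\<lambda>x. \<eta>' (norm x) *\<^sub>R sgn x)"
    using grad_unique[OF D] by auto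
  show "norm (grad (\<lambda>x::'a. \<eta> (norm x)) x) = \<bar>\<eta>' (norm x)\<bar>"
    using z by (cases "x = 0") (auto simp: G norm_sgn)
  have cn: "continuous_on UNIV (\<lambda>x::'a. \<eta>' (norm x))"
    by (rule continuous_on_compose2[OF c]) (auto intro: continuous_intros)
  have "continuous (at x) (\<lambda>x. \<eta>' (norm x) *\<^sub>R sgn x)" for x :: 'a
  proof (cases "x = 0")
    case True
    have l: "((\<lambda>x::'a. \<bar>\<eta>' (norm x)\<bar>) \<longlongrightarrow> 0) (at 0)"
      using cn[unfolded continuous_on_def, rule_format, of 0] z by (intro tendsto_rabs_zero) simp
    have "((\<lambda>x::'a. \<eta>' (norm x) *\<^sub>R sgn x) \<longlongrightarrow> 0) (at 0)"
      by (rule Lim_null_comparison[OF _ l]) (auto simp: norm_sgn)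
    then show ?thesis by (simp add: True continuous_at)
  next
    case False
    then show ?thesis
      using cn by (intro continuous_intros) (auto simp: continuous_on_eq_continuous_at)
  qed
  then have "continuous_on UNIV (grad (\<lambda>x::'a. \<eta> (norm x)))"
    by (simp add: G continuous_at_imp_continuous_on)
  moreover have "{x::'a. \<eta> (norm x) \<noteq> 0} \<subseteq> cball 0 R"
    using supp by (auto simp: not_less[symmetric])
  then have "bounded {x::'a. \<eta> (norm x) \<noteq> 0}"
    using bounded_cball bounded_subset by blast
  ultimately show "(\<lambda>x::'a. \<eta> (norm x)) \<in> C1_0"
    using D by (auto simp: C1_0_def C1_def differentiable_def)
qed

lemma stable_radial_form_nonneg:
  fixes v \<eta> \<eta>' :: "real \<Rightarrow> real"
  assumes f': "continuous_on UNIV (deriv f)" and v: "continuous_on {0..} v"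
    and stab: "\<And>\<phi>. \<phi> \<in> C1_0 \<Longrightarrow> stability_form f (\<lambda>x::'a::euclidean_space. v (norm x)) \<phi> \<ge> 0"
    and d: "\<And>r. r > 0 \<Longrightarrow> (\<eta> has_real_derivative \<eta>' r) (at r)"
    and d0: "(\<eta> has_real_derivative 0) (at 0 within {0..})" and z: "\<eta>' 0 = 0"
    and c: "continuous_on {0..} \<eta>'"
    and supp: "\<And>r. r > R \<Longrightarrow> \<eta> r = 0" "\<And>r. r > R \<Longrightarrow> \<eta>' r = 0"
  shows "0 \<le> integral {0..R} (\<lambda>r. r ^ (DIM('a) - 1) * ((\<eta>' r)\<^sup>2 - deriv f (v r) * (\<eta> r)\<^sup>2))"
    (is "0 \<le> ?I")
proof -
  note T = radial_in_C1_0[OF d d0 z c supp(1), where ?'a = 'a]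
  have \<eta>: "continuous_on {0..} \<eta>"
    unfolding continuous_on_eq_continuous_within
  proof
    fix r :: real assume "r \<in> {0..}"
    then show "continuous (at r within {0..}) \<eta>"
      using DERIV_isCont[OF d] DERIV_continuous[OF d0]
      by (cases "r = 0") (auto intro: continuous_at_imp_continuous_at_within)
  qed
  have "continuous_on {0..R} (\<lambda>r. (\<eta>' r)\<^sup>2 - deriv f (v r) * (\<eta> r)\<^sup>2)"
    by (intro continuous_intros continuous_on_compose2[OF f']
          continuous_on_subset[OF \<eta>] continuous_on_subset[OF c] continuous_on_subset[OF v]) auto
  then have "stability_form f (\<lambda>x::'a. v (norm x)) (\<lambda>x. \<eta> (norm x)) = real DIM('a) * unit_ball_vol DIM('a) * ?I"
    using integral_radial[of R "\<lambda>r. (\<eta>' r)\<^sup>2 - deriv f (v r) * (\<eta> r)\<^sup>2", where ?'a = 'a] supp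
    by (simp add: stability_form_def T(2))
  with stab[OF T(1)] have "0 \<le> (real DIM('a) * unit_ball_vol DIM('a)) * ?I" by simp
  moreover have "0 < real DIM('a) * unit_ball_vol DIM('a)" by simp
  ultimately show ?thesis by (meson zero_le_mult_iff not_less)
qed

text \<open>The test function is psi(w) with psi(s) = s^2/(s+\<epsilon>), extended by zero. Since 0
  \<le> psi' \<le> 1, the gradient term does not grow; since w^2 - psi(w)^2 \<le> 2 \<epsilon> w,
  the potential term changes by at most 2 \<epsilon> C. Letting \<epsilon> tend to 0 gives the
  inequality for w itself.\<close>

lemma stable_dirichlet_form_nonneg:
  fixes v w w' :: "real \<Rightarrow> real"
  assumes f': "continuous_on UNIV (deriv f)" "\<And>s. deriv f s \<ge> 0"
    and v: "continuous_on {0..} v"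
    and stab: "\<And>\<phi>. \<phi> \<in> C1_0 \<Longrightarrow> stability_form f (\<lambda>x::'a::euclidean_space. v (norm x)) \<phi> \<ge> 0"
    and dw: "\<And>r. r \<ge> 0 \<Longrightarrow> (w has_real_derivative w' r) (at r within {0..})"
    and w'0: "w' 0 = 0" and cw': "continuous_on {0..} w'"
    and R: "R > 0" and wpos: "\<And>r. 0 \<le> r \<Longrightarrow> r < R \<Longrightarrow> w r > 0" and wR: "w R = 0"
  shows "0 \<le> integral {0..R} (\<lambda>r. r ^ (DIM('a) - 1) * ((w' r)\<^sup>2 - deriv f (v r) * (w r)\<^sup>2))"
    (is "0 \<le> integral _ ?q")
proof (rule field_le_epsilon)
  have cw: "continuous_on {0..} w"
    by (rule DERIV_continuous_on[where D = w']) (use dw in auto)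
  have wnn: "w r \<ge> 0" if "0 \<le> r" "r \<le> R" for r
    using wpos[of r] wR that by (cases "r = R") auto
  have dw_at: "(w has_real_derivative w' r) (at r)" if "r > 0" for r
    using dw[of r] that at_within_interior[of r "{0..}"] by (simp add: interior_Ici)
  define C where "C = integral {0..R} (\<lambda>r. r ^ (DIM('a) - 1) * (deriv f (v r) * w r))"
  have contC: "continuous_on {0..R} (\<lambda>r. r ^ (DIM('a) - 1) * (deriv f (v r) * w r))"
    and contq: "continuous_on {0..R} ?q"
    by (intro continuous_intros continuous_on_compose2[OF f'(1)] continuous_on_subset[OF cw]
          continuous_on_subset[OF cw'] continuous_on_subset[OF v]; auto)+
  have C0: "C \<ge> 0"
    unfolding C_def using f'(2) wnn
    by (intro integral_nonneg integrable_continuous_interval contC) auto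
  fix e :: real assume e: "e > 0"
  \<comment> \<open>Chosen so that the total error 2 \<epsilon> C is at most e; C + 1 avoids
    division by zero when C = 0.\<close>
  define \<epsilon> where "\<epsilon> = e / (2 * (C + 1))"
  have \<epsilon>: "\<epsilon> > 0" using e C0 by (simp add: \<epsilon>_def)
  \<comment> \<open>the truncation of w at R is only Lipschitz, whereas s^2/(s+\<epsilon>) vanishes to second order at 0\<close>
  define \<eta> where "\<eta> r = (if r \<le> R then (w r)\<^sup>2 / (w r + \<epsilon>) else 0)" for r
  define \<eta>' where "\<eta>' r = (if r \<le> R then w r * (w r + 2 * \<epsilon>) / (w r + \<epsilon>)\<^sup>2 * w' r else 0)" for r
  have D: "((\<lambda>r. (w r)\<^sup>2 / (w r + \<epsilon>)) has_real_derivative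
              w r * (w r + 2 * \<epsilon>) / (w r + \<epsilon>)\<^sup>2 * w' r) (at r within {0..})"
    if "0 \<le> r" "r \<le> R" for r
    using dw[OF that(1)] wnn[OF that] \<epsilon>
    by (auto intro!: derivative_eq_intros simp: power2_eq_square field_simps)
  have d: "(\<eta> has_real_derivative \<eta>' r) (at r)" if r: "r > 0" for r
  proof -
    consider "r < R" | "r = R" | "r > R" by linarith
    then show ?thesis
    proof cases
      case 1
      have "((\<lambda>r. (w r)\<^sup>2 / (w r + \<epsilon>)) has_real_derivative \<eta>' r) (at r)"
        using D[of r] r 1 at_within_interior[of r "{0..}"] by (simp add: interior_Ici \<eta>'_def)
      then show ?thesis
        by (rule has_field_derivative_transform_within_open[where S = "{..<R}"])
           (use 1 in \<open>auto simp: \<eta>_def\<close>)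
    next
      case 3
      have "((\<lambda>r. 0) has_real_derivative \<eta>' r) (at r)"
        using 3 by (simp add: \<eta>'_def)
      then show ?thesis
        by (rule has_field_derivative_transform_within_open[where S = "{R<..}"])
           (use 3 in \<open>auto simp: \<eta>_def\<close>)
    next
      case 2
      \<comment> \<open>Squeeze at the junction: to the left of R the quotient of \<eta> is at most
        the quotient of w, which converges, times w/\<epsilon>, which tends to 0; to the right it is
        0.\<close>
      have l1: "((\<lambda>y. (w y - w R) / (y - R)) \<longlongrightarrow> w' R) (at R)"
        using dw_at[OF R] by (simp add: has_field_derivative_iff)
      have l2: "(w \<longlongrightarrow> w R) (at R)"
        using DERIV_isCont[OF dw_at[OF R]] by (simp add: isCont_def)
      have "((\<lambda>y. \<bar>(w y - w R) / (y - R)\<bar> * (\<bar>w y\<bar> / \<epsilon>)) \<longlongrightarrow> \<bar>w' R\<bar> * (\<bar>w R\<bar> / \<epsilon>)) (at R)"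
        using \<epsilon> by (intro tendsto_intros l1 l2) auto
      then have l3: "((\<lambda>y. \<bar>w y / (y - R)\<bar> * (\<bar>w y\<bar> / \<epsilon>)) \<longlongrightarrow> 0) (at R)"
        by (simp add: wR)
      have "\<forall>\<^sub>F y in at R. norm ((\<eta> y - \<eta> R) / (y - R)) \<le> \<bar>w y / (y - R)\<bar> * (\<bar>w y\<bar> / \<epsilon>)"
      proof -
        have "norm ((\<eta> y - \<eta> R) / (y - R)) \<le> \<bar>w y / (y - R)\<bar> * (\<bar>w y\<bar> / \<epsilon>)" if "y > 0" for y
        proof (cases "y \<le> R")
          case True
          then have "w y \<ge> 0" using wnn that by simp
          then have "(w y)\<^sup>2 / (w y + \<epsilon>) \<le> (w y)\<^sup>2 / \<epsilon>"
            using \<epsilon> by (intro divide_left_mono) auto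
          then have "(w y)\<^sup>2 / (w y + \<epsilon>) / \<bar>y - R\<bar> \<le> (w y)\<^sup>2 / \<epsilon> / \<bar>y - R\<bar>"
            by (intro divide_right_mono) auto
          then show ?thesis
            using True \<open>w y \<ge> 0\<close> \<epsilon> by (simp add: \<eta>_def wR abs_mult power2_eq_square mult_ac)
        qed (use \<epsilon> in \<open>simp add: \<eta>_def wR\<close>)
        moreover have "\<forall>\<^sub>F y in at R. y > 0"
          using order_tendstoD(1)[OF tendsto_ident_at R] .
        ultimately show ?thesis by (auto elim: eventually_mono)
      qed
      from Lim_null_comparison[OF this l3]
      show ?thesis by (simp add: 2 has_field_derivative_iff \<eta>'_def wR)
    qed
  qed
  have d0: "(\<eta> has_real_derivative 0) (at 0 within {0..})"
    by (rule has_field_derivative_transform_within[where d = R and f = "\<lambda>r. (w r)\<^sup>2 / (w r + \<epsilon>)"])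
       (use D[of 0] R w'0 in \<open>auto simp: \<eta>_def dist_real_def\<close>)
  have z: "\<eta>' 0 = 0" by (simp add: \<eta>'_def w'0)
  have c: "continuous_on {0..} \<eta>'"
    unfolding \<eta>'_def
  proof (rule continuous_on_cases_le)
    have "w r + \<epsilon> \<noteq> 0" if "r \<in> {t \<in> {0..}. t \<le> R}" for r
      using wnn[of r] that \<epsilon> by auto
    then show "continuous_on {t \<in> {0..}. t \<le> R} (\<lambda>r. w r * (w r + 2 * \<epsilon>) / (w r + \<epsilon>)\<^sup>2 * w' r)"
      by (intro continuous_intros continuous_on_subset[OF cw] continuous_on_subset[OF cw']) auto
  qed (use wR in \<open>auto intro: continuous_intros\<close>)
  have "0 \<le> integral {0..R} (\<lambda>r. r ^ (DIM('a) - 1) * ((\<eta>' r)\<^sup>2 - deriv f (v r) * (\<eta> r)\<^sup>2))"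
    by (rule stable_radial_form_nonneg[OF f'(1) v stab d d0 z c]) (auto simp: \<eta>_def \<eta>'_def)
  also have "\<dots> \<le> integral {0..R} (\<lambda>r. ?q r + 2 * \<epsilon> * (r ^ (DIM('a) - 1) * (deriv f (v r) * w r)))"
  proof (rule integral_le)
    have c\<eta>: "continuous_on {0..R} \<eta>"
    proof -
      have "\<And>r. 0 \<le> r \<Longrightarrow> r \<le> R \<Longrightarrow> w r + \<epsilon> \<noteq> 0" using wnn \<epsilon> by (metis add_nonneg_pos less_irrefl)
      then have "continuous_on {0..R} (\<lambda>r. (w r)\<^sup>2 / (w r + \<epsilon>))"
        by (intro continuous_intros continuous_on_subset[OF cw]) auto
      then show ?thesis by (rule continuous_on_eq) (auto simp: \<eta>_def)
    qed
    show "(\<lambda>r. r ^ (DIM('a) - 1) * ((\<eta>' r)\<^sup>2 - deriv f (v r) * (\<eta> r)\<^sup>2)) integrable_on {0..R}"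
      by (intro integrable_continuous_interval continuous_intros c\<eta> continuous_on_compose2[OF f'(1)]
          continuous_on_subset[OF c] continuous_on_subset[OF v]) auto
    show "(\<lambda>r. ?q r + 2 * \<epsilon> * (r ^ (DIM('a) - 1) * (deriv f (v r) * w r))) integrable_on {0..R}"
      by (intro integrable_continuous_interval continuous_on_add contq continuous_on_mult_left contC)
    fix r assume r: "r \<in> {0..R}"
    then have w0: "w r \<ge> 0" using wnn by auto
    \<comment> \<open>This factor is psi'(w r) = 1 - \<epsilon>^2/(w r + \<epsilon>)^2, hence
      between 0 and 1.\<close>
    have "w r * (w r + 2 * \<epsilon>) / (w r + \<epsilon>)\<^sup>2 \<le> 1" "w r * (w r + 2 * \<epsilon>) / (w r + \<epsilon>)\<^sup>2 \<ge> 0"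
      using w0 \<epsilon> zero_less_power[of "w r + \<epsilon>" 2]
      by (simp_all add: divide_le_eq_1_pos) (simp add: power2_eq_square algebra_simps)
    then have "(w r * (w r + 2 * \<epsilon>) / (w r + \<epsilon>)\<^sup>2)\<^sup>2 * (w' r)\<^sup>2 \<le> 1 * (w' r)\<^sup>2"
      by (intro mult_right_mono power_le_one) auto
    then have 1: "(\<eta>' r)\<^sup>2 \<le> (w' r)\<^sup>2" using r by (simp add: \<eta>'_def flip: power_mult_distrib)
    have "w r - \<eta> r = \<epsilon> * (w r / (w r + \<epsilon>))"
      using r w0 \<epsilon> by (simp add: \<eta>_def field_simps power2_eq_square)
    also have "\<dots> \<le> \<epsilon> * 1" using w0 \<epsilon> by (intro mult_left_mono) (auto simp: field_simps)
    finally have le: "w r - \<eta> r \<le> \<epsilon>" by simp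
    have \<eta>w: "0 \<le> \<eta> r" "\<eta> r \<le> w r"
      using r w0 \<epsilon> by (auto simp: \<eta>_def field_simps power2_eq_square)
    have "(w r)\<^sup>2 - (\<eta> r)\<^sup>2 = (w r - \<eta> r) * (w r + \<eta> r)" by (simp add: power2_eq_square algebra_simps)
    also have "\<dots> \<le> \<epsilon> * (2 * w r)" using le \<eta>w \<epsilon> by (intro mult_mono) auto
    finally have "(w r)\<^sup>2 - 2 * \<epsilon> * w r \<le> (\<eta> r)\<^sup>2" by simp
    then have "deriv f (v r) * ((w r)\<^sup>2 - 2 * \<epsilon> * w r) \<le> deriv f (v r) * (\<eta> r)\<^sup>2"
      by (intro mult_left_mono f'(2))
    with 1 have "(\<eta>' r)\<^sup>2 - deriv f (v r) * (\<eta> r)\<^sup>2 \<le> (w' r)\<^sup>2 - deriv f (v r) * (w r)\<^sup>2 + 2 * \<epsilon> * (deriv f (v r) * w r)"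
      by (simp add: algebra_simps)
    then have "r ^ (DIM('a) - 1) * ((\<eta>' r)\<^sup>2 - deriv f (v r) * (\<eta> r)\<^sup>2) \<le> r ^ (DIM('a) - 1) * ((w' r)\<^sup>2 - deriv f (v r) * (w r)\<^sup>2 + 2 * \<epsilon> * (deriv f (v r) * w r))"
      using r by (intro mult_left_mono) auto
    then show "r ^ (DIM('a) - 1) * ((\<eta>' r)\<^sup>2 - deriv f (v r) * (\<eta> r)\<^sup>2) \<le> ?q r + 2 * \<epsilon> * (r ^ (DIM('a) - 1) * (deriv f (v r) * w r))"
      by (simp add: algebra_simps)
  qed
  also have "\<dots> = integral {0..R} ?q + 2 * \<epsilon> * C"
    unfolding C_def
    by (subst Henstock_Kurzweil_Integration.integral_add[OF integrable_continuous_interval[OF contq]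
          integrable_continuous_interval[OF continuous_on_mult_left[OF contC]]]) simp
  also have "2 * \<epsilon> * C \<le> e" using e C0 by (simp add: \<epsilon>_def field_simps)
  finally show "0 \<le> integral {0..R} ?q + e" by simp
qed

section \<open>Regular solutions as a first-order system, and their comparison\<close>

text \<open>The derivative is carried as a separate function so that it has a meaningful value at 0,
  where \<open>deriv\<close> would look at negative radii. The central value is left free, so the
  zero function is also a profile and can serve as a barrier.\<close>

definition regular_profile ::
  "nat \<Rightarrow> (real \<Rightarrow> real) \<Rightarrow> (real \<Rightarrow> real) \<Rightarrow> (real \<Rightarrow> real) \<Rightarrow> bool" where
  "regular_profile N f v v' \<longleftrightarrow>
     continuous_on {0..} v' \<and> v' 0 = 0 \<and>
     (\<forall>r\<ge>0. (v has_real_derivative v' r) (at r within {0..})) \<and>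
     (\<forall>r>0. (v' has_real_derivative - (real N - 1) / r * v' r - f (v r)) (at r))"

lemma regular_profile_continuous:
  assumes "regular_profile N f v v'" shows "continuous_on {0..} v" "continuous_on {0..} v'"
proof -
  show "continuous_on {0..} v"
    by (rule DERIV_continuous_on[where D = v']) (use assms in \<open>auto simp: regular_profile_def\<close>)
qed (use assms in \<open>auto simp: regular_profile_def\<close>)

lemma regular_profile_DERIV:
  assumes "regular_profile N f v v'" "r > 0"
  shows "(v has_real_derivative v' r) (at r)"
    and "(v' has_real_derivative - (real N - 1) / r * v' r - f (v r)) (at r)"
  using assms at_within_interior[of r "{0..}"]
  by (auto simp: regular_profile_def interior_Ici dest!: spec[where x = r])

text \<open>Divergence form of the radial equation. The source g is an arbitrary number, so the
  lemma serves a single solution as well as the difference of two.\<close>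

lemma flux_DERIV:
  assumes "(v' has_real_derivative - (real N - 1) / r * v' r - g) (at r)" "r > 0" "N \<ge> 1"
  shows "((\<lambda>s. s ^ (N - 1) * v' s) has_real_derivative - (r ^ (N - 1) * g)) (at r)"
proof (cases "N = 1")
  case True
  then show ?thesis using assms by simp
next
  case False
  then obtain m where m: "N = Suc (Suc m)"
    using assms(3) by (intro that[of "N - 2"]) simp
  have "((\<lambda>s. s ^ Suc m) has_real_derivative real (Suc m) * r ^ m) (at r)"
    using DERIV_pow[of "Suc m" r] by simp
  from DERIV_mult[OF this assms(1)] show ?thesis
    using assms(2) by (simp add: m field_simps)
qed

lemma strictly_convex_tangent:
  assumes "\<And>x. (f has_real_derivative f' x) (at x)"
    and "\<And>x y. b < x \<Longrightarrow> x < y \<Longrightarrow> f' x < f' y" and "b < (a::real)"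
  shows "f a - f b < f' a * (a - b)"
proof -
  obtain z where z: "b < z" "z < a" "f a - f b = (a - b) * f' z"
    using MVT2[OF assms(3), of f f'] assms(1) by blast
  have "f' z < f' a" using z assms(2) by blast
  then show ?thesis using z assms(3) by (simp add: mult.commute)
qed

text \<open>R is the least element of the compact set of points of [0,r] with w \<le> 0; a negative
  value there would produce an earlier zero by the intermediate value theorem.\<close>

lemma first_nonpositive_point:
  fixes w :: "real \<Rightarrow> real"
  assumes c: "continuous_on {0..} w" and "w 0 > 0" and "r \<ge> 0" "w r \<le> 0"
  obtains R where "R > 0" "w R = 0" "\<And>s. 0 \<le> s \<Longrightarrow> s < R \<Longrightarrow> w s > 0"
proof -
  let ?S = "{s \<in> {0..r}. w s \<le> 0}"
  have "closed ?S"
    using continuous_on_closed_Collect_le[of "{0..r}" w "\<lambda>_. 0"] continuous_on_subset[OF c, of "{0..r}"]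
    by auto
  then have "compact ?S"
    by (intro compact_eq_bounded_closed[THEN iffD2] conjI bounded_subset[OF bounded_closed_interval[of 0 r]]) auto
  moreover have "r \<in> ?S" using assms by auto
  ultimately obtain R where R: "R \<in> ?S" "\<And>s. s \<in> ?S \<Longrightarrow> R \<le> s"
    using compact_attains_inf[of ?S] by blast
  have pos: "w s > 0" if "0 \<le> s" "s < R" for s
    using R(1) R(2)[of s] that by force
  have "R \<noteq> 0" using R(1) assms(2) by auto
  then have "R > 0" using R(1) by auto
  moreover have "w R = 0"
  proof (rule ccontr)
    assume "w R \<noteq> 0"
    then have "w R < 0" using R(1) by auto
    have "continuous_on {0..R} w" by (rule continuous_on_subset[OF c]) auto
    with IVT2'[of w R 0 0] \<open>w R < 0\<close> assms(2) \<open>R > 0\<close>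
    obtain s where "0 \<le> s" "s \<le> R" "w s = 0" by auto
    with pos[of s] \<open>w R \<noteq> 0\<close> show False by (cases "s = R") auto
  qed
  ultimately show thesis using that pos by blast
qed

text \<open>At a first contact radius R, testing the equation for w = v - z with w gives a zero
  integral, while the tangent inequality taken at the larger value v makes the stability form of v
  strictly smaller. Only v has to be stable, so z may be the zero profile.\<close>

lemma stable_profile_gt:
  fixes v z :: "real \<Rightarrow> real"
  assumes f: "\<And>x. (f has_real_derivative deriv f x) (at x)" "continuous_on UNIV (deriv f)"
      "\<And>s. deriv f s \<ge> 0" "\<And>x y. 0 < x \<Longrightarrow> x < y \<Longrightarrow> deriv f x < deriv f y"
    and v: "regular_profile DIM('a) f v v'" and z: "regular_profile DIM('a) f z z'"
    and stab: "\<And>\<phi>. \<phi> \<in> C1_0 \<Longrightarrow> stability_form f (\<lambda>x::'a::euclidean_space. v (norm x)) \<phi> \<ge> 0"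
    and z0: "\<And>r. r \<ge> 0 \<Longrightarrow> z r \<ge> 0" and init: "z 0 < v 0" and r: "r \<ge> 0"
  shows "z r < v r"
proof (rule ccontr)
  assume "\<not> z r < v r"
  let ?N = "DIM('a)"
  define w w' where "w s = v s - z s" and "w' s = v' s - z' s" for s
  note cv = regular_profile_continuous[OF v] and cz = regular_profile_continuous[OF z]
  have cw: "continuous_on {0..} w" "continuous_on {0..} w'"
    unfolding w_def w'_def by (intro continuous_intros cv cz)+
  obtain R where R: "R > 0" "w R = 0" "\<And>s. 0 \<le> s \<Longrightarrow> s < R \<Longrightarrow> w s > 0"
    by (rule first_nonpositive_point[OF cw(1) _ r])
       (use init \<open>\<not> z r < v r\<close> in \<open>auto simp: w_def\<close>)
  have dw: "(w has_real_derivative w' s) (at s within {0..})" if "s \<ge> 0" for s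
    using v z that unfolding regular_profile_def w_def w'_def by (auto intro!: derivative_intros)
  have w'0: "w' 0 = 0" using v z by (simp add: regular_profile_def w'_def)
  define g where "g s = f (v s) - f (z s)" for s
  have cf: "continuous_on UNIV f" using f(1) DERIV_isCont continuous_at_imp_continuous_on by blast
  have cg: "continuous_on {0..} g"
    unfolding g_def by (intro continuous_intros continuous_on_compose2[OF cf] cv cz) auto
  have "integral {0..R} (\<lambda>s. s ^ (?N - 1) * ((w' s)\<^sup>2 - deriv f (v s) * (w s)\<^sup>2))
      < integral {0..R} (\<lambda>s. s ^ (?N - 1) * ((w' s)\<^sup>2 - g s * w s))"
  proof (rule integral_less_real)
    show "continuous_on {0..R} (\<lambda>s. s ^ (?N - 1) * ((w' s)\<^sup>2 - deriv f (v s) * (w s)\<^sup>2))"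
      by (intro continuous_intros continuous_on_compose2[OF f(2)] continuous_on_subset[OF cw(1)]
          continuous_on_subset[OF cw(2)] continuous_on_subset[OF cv(1)]) auto
    show "continuous_on {0..R} (\<lambda>s. s ^ (?N - 1) * ((w' s)\<^sup>2 - g s * w s))"
      by (intro continuous_intros continuous_on_subset[OF cw(1)]
          continuous_on_subset[OF cw(2)] continuous_on_subset[OF cg]) auto
    show "{0<..<R} \<noteq> {}" using R(1) by simp
    fix s assume s: "s \<in> {0<..<R}"
    then have ws: "w s > 0" using R by auto
    \<comment> \<open>z s \<ge> 0 keeps the segment from z s to v s in the range where f' is
      strictly increasing, except possibly for its left endpoint.\<close>
    have "g s < deriv f (v s) * w s"
      using strictly_convex_tangent[OF f(1), of "z s" "v s"] f(4) z0[of s] s ws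
      unfolding g_def w_def by force
    then have "g s * w s < deriv f (v s) * w s * w s" using ws by (intro mult_strict_right_mono)
    then have "(w' s)\<^sup>2 - deriv f (v s) * (w s)\<^sup>2 < (w' s)\<^sup>2 - g s * w s"
      by (simp add: power2_eq_square mult_ac)
    then show "s ^ (?N - 1) * ((w' s)\<^sup>2 - deriv f (v s) * (w s)\<^sup>2) < s ^ (?N - 1) * ((w' s)\<^sup>2 - g s * w s)"
      using s by (intro mult_strict_left_mono) auto
  qed
  \<comment> \<open>The integrand is the derivative of s^(N-1) w' w. The boundary terms vanish
    because w R = 0 and w' 0 = 0.\<close>
  also have "integral {0..R} (\<lambda>s. s ^ (?N - 1) * ((w' s)\<^sup>2 - g s * w s)) = 0"
  proof -
    have "((\<lambda>s. s ^ (?N - 1) * ((w' s)\<^sup>2 - g s * w s)) has_integral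
            (R ^ (?N - 1) * w' R * w R - 0 ^ (?N - 1) * w' 0 * w 0)) {0..R}"
    proof (rule fundamental_theorem_of_calculus_interior)
      show "continuous_on {0..R} (\<lambda>s. s ^ (?N - 1) * w' s * w s)"
        by (intro continuous_intros continuous_on_subset[OF cw(1)] continuous_on_subset[OF cw(2)]) auto
      fix s assume s: "s \<in> {0<..<R}"
      then have s0: "s > 0" by simp
      have "(w' has_real_derivative - (real ?N - 1) / s * w' s - g s) (at s)"
        unfolding w'_def g_def
        by (rule DERIV_cong[OF DERIV_diff[OF regular_profile_DERIV(2)[OF v s0] regular_profile_DERIV(2)[OF z s0]]])
           (simp add: diff_divide_distrib algebra_simps)
      from flux_DERIV[OF this s0] DIM_positive[where 'a = 'a]
      have 1: "((\<lambda>s. s ^ (?N - 1) * w' s) has_real_derivative - (s ^ (?N - 1) * g s)) (at s)" by simp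
      have 2: "(w has_real_derivative w' s) (at s)"
        unfolding w_def w'_def
        by (intro DERIV_diff regular_profile_DERIV(1)[OF v s0] regular_profile_DERIV(1)[OF z s0])
      have "((\<lambda>s. s ^ (?N - 1) * w' s * w s) has_real_derivative s ^ (?N - 1) * ((w' s)\<^sup>2 - g s * w s)) (at s)"
        by (rule DERIV_cong[OF DERIV_mult[OF 1 2]]) (simp add: algebra_simps power2_eq_square)
      then show "((\<lambda>s. s ^ (?N - 1) * w' s * w s) has_vector_derivative s ^ (?N - 1) * ((w' s)\<^sup>2 - g s * w s)) (at s)"
        by (simp add: has_real_derivative_iff_has_vector_derivative)
    qed (use R in auto)
    then show ?thesis using R(2) w'0 by (simp add: integral_unique)
  qed
  finally show False
    using stable_dirichlet_form_nonneg[OF f(2,3) cv(1) stab dw w'0 cw(2) R(1) R(3) R(2)] by simp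
qed

text \<open>The initial condition gives only a one-sided derivative at 0; continuity of the
  derivative there has to be extracted from the equation, through a bound |v'(r)| \<le> M r near 0.
  The value at 0 is set by hand because \<open>deriv v 0\<close> depends on irrelevant negative
  radii.\<close>

lemma regular_profile_ivp:
  assumes v: "radial_ivp_solution N f \<alpha> v" and f: "continuous_on UNIV f" and N: "N \<ge> 2"
  shows "regular_profile N f v (\<lambda>r. if r \<le> 0 then 0 else deriv v r)"
proof -
  let ?v' = "\<lambda>r. if r \<le> 0 then 0 else deriv v r"
  have C2: "C2_on {0<..} v"
    and ode: "\<And>r. r > 0 \<Longrightarrow> deriv (deriv v) r + (real N - 1) / r * deriv v r + f (v r) = 0"
    and d0: "(v has_real_derivative 0) (at 0 within {0..})"
    using v by (auto simp: radial_ivp_solution_def radial_solution_def)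
  have dv: "(v has_real_derivative deriv v r) (at r)" if "r > 0" for r
    using C2 that by (auto simp: C2_on_def DERIV_deriv_iff_real_differentiable)
  have ddv: "(deriv v has_real_derivative - (real N - 1) / r * deriv v r - f (v r)) (at r)"
    if "r > 0" for r
  proof -
    have "(deriv v has_real_derivative deriv (deriv v) r) (at r)"
      using C2 that by (auto simp: C2_on_def DERIV_deriv_iff_real_differentiable)
    then show ?thesis
      by (rule DERIV_cong) (use ode[OF that] in \<open>simp add: algebra_simps diff_divide_distrib\<close>)
  qed
  have cv: "continuous_on {0..} v"
    unfolding continuous_on_eq_continuous_within
  proof
    fix r :: real assume "r \<in> {0..}"
    then show "continuous (at r within {0..}) v"
      using DERIV_isCont[OF dv] DERIV_continuous[OF d0]
      by (cases "r = 0") (auto intro: continuous_at_imp_continuous_at_within)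
  qed
  have "compact ((\<lambda>s. f (v s)) ` {0..1})"
    by (intro compact_continuous_image continuous_on_compose2[OF f] continuous_on_subset[OF cv]) auto
  then obtain M where M: "\<And>s. 0 \<le> s \<Longrightarrow> s \<le> 1 \<Longrightarrow> \<bar>f (v s)\<bar> \<le> M"
    using compact_imp_bounded by (force simp: bounded_iff)
  have M0: "M \<ge> 0" using M[of 0] by auto
  have bound: "\<bar>deriv v r\<bar> \<le> M * r" if r: "0 < r" "r \<le> 1" for r
  proof -
    define P where "P s = s ^ (N - 1) * deriv v s" for s
    have "\<bar>P r\<bar> \<le> r ^ (N - 1) * (M * r)"
    \<comment> \<open>That the flux P tends to 0 at the origin is not yet known. Instead, a small
      difference quotient on [0,y] yields a point \<xi> < y with |v'(\<xi>)| \<le> 1, and N \<ge> 2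
      gives |P \<xi>| \<le> \<xi> \<le> e. From \<xi> to r the mean value theorem controls the
      change of P.\<close>
    proof (rule field_le_epsilon)
      fix e :: real assume e: "e > 0"
      have "\<forall>\<^sub>F y in at 0 within {0..}. \<bar>(v y - v 0) / (y - 0)\<bar> < 1"
        using order_tendstoD(2)[OF tendsto_rabs_zero[OF d0[unfolded has_field_derivative_iff]], of 1] by simp
      then obtain d where d: "d > 0" "\<And>y. y > 0 \<Longrightarrow> y < d \<Longrightarrow> \<bar>(v y - v 0) / y\<bar> < 1"
        by (auto simp: eventually_at dist_real_def)
      define y where "y = Min {d / 2, e, r / 2}"
      have y: "y > 0" "y < d" "y \<le> e" "y < r" using d e r by (auto simp: y_def min_def)
      obtain \<xi> where xi: "0 < \<xi>" "\<xi> < y" "v y - v 0 = (y - 0) * deriv v \<xi>"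
      proof -
        have "continuous_on {0..y} v" by (rule continuous_on_subset[OF cv]) auto
        then have "\<exists>l z. 0 < z \<and> z < y \<and> (v has_real_derivative l) (at z) \<and> v y - v 0 = (y - 0) * l"
          using dv y by (intro MVT) (auto simp: real_differentiable_def)
        then show thesis using that DERIV_imp_deriv by metis
      qed
      have "\<bar>deriv v \<xi>\<bar> \<le> 1" using d(2)[of y] xi y by simp
      moreover have "\<xi> ^ (N - 1) \<le> \<xi> ^ 1" using xi y r N by (intro power_decreasing) auto
      ultimately have "\<xi> ^ (N - 1) * \<bar>deriv v \<xi>\<bar> \<le> \<xi> * 1"
        using xi by (intro mult_mono) auto
      then have 1: "\<bar>P \<xi>\<bar> \<le> e" using xi y by (simp add: P_def abs_mult)
      have "\<exists>z. \<xi> < z \<and> z < r \<and> P r - P \<xi> = (r - \<xi>) * (- (z ^ (N - 1) * f (v z)))"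
        unfolding P_def using xi y N
        by (intro MVT2[where f = "\<lambda>s. s ^ (N - 1) * deriv v s"] flux_DERIV ddv) auto
      then obtain z where z: "\<xi> < z" "z < r" "P r - P \<xi> = (r - \<xi>) * (- (z ^ (N - 1) * f (v z)))" by blast
      have "\<bar>P r - P \<xi>\<bar> = (r - \<xi>) * (z ^ (N - 1) * \<bar>f (v z)\<bar>)"
        using z xi by (simp add: abs_mult)
      also have "\<dots> \<le> r * (r ^ (N - 1) * M)"
        using z xi r M0 by (intro mult_mono power_mono M) auto
      finally show "\<bar>P r\<bar> \<le> r ^ (N - 1) * (M * r) + e" using 1 by (simp add: mult_ac)
    qed
    then show ?thesis using r by (simp add: P_def abs_mult)
  qed
  have lim: "(?v' \<longlongrightarrow> 0) (at 0 within {0..})"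
  proof (rule Lim_null_comparison)
    show "((\<lambda>r. M * r) \<longlongrightarrow> 0) (at 0 within {0..})" by (auto intro!: tendsto_eq_intros)
    show "\<forall>\<^sub>F r in at 0 within {0..}. norm (?v' r) \<le> M * r"
      unfolding eventually_at using bound by (intro exI[of _ 1]) (auto simp: dist_real_def)
  qed
  have loc: "(?v' has_real_derivative D) (at r)" if "(deriv v has_real_derivative D) (at r)" "r > 0" for r D
    by (rule has_field_derivative_transform_within_open[OF that(1), where S = "{0<..}"]) (use that in auto)
  have "continuous_on {0..} ?v'"
    unfolding continuous_on_eq_continuous_within
  proof
    fix r :: real assume "r \<in> {0..}"
    then show "continuous (at r within {0..}) ?v'"
      using continuous_at_imp_continuous_at_within[OF DERIV_isCont[OF loc[OF ddv[of r]]], of "{0..}"] lim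
      by (cases "r = 0") (auto simp: continuous_within)
  qed
  moreover have "(v has_real_derivative ?v' r) (at r within {0..})" if "r \<ge> 0" for r
    using dv[of r] d0 that by (cases "r = 0") (auto intro: has_field_derivative_at_within)
  moreover have "(?v' has_real_derivative - (real N - 1) / r * ?v' r - f (v r)) (at r)" if "r > 0" for r
    using loc[OF ddv[OF that] that] that by simp
  ultimately show ?thesis by (simp add: regular_profile_def)
qed

section \<open>Estimates uniform in the central value\<close>

lemma flux_antimono:
  assumes "regular_profile N f v v'" "N \<ge> 1" "\<And>s. s > 0 \<Longrightarrow> f (v s) \<ge> 0" "0 \<le> a" "a \<le> b"
  shows "b ^ (N - 1) * v' b \<le> a ^ (N - 1) * v' a"
proof (rule DERIV_nonpos_imp_decreasing_open[OF assms(5)])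
  show "continuous_on {a..b} (\<lambda>s. s ^ (N - 1) * v' s)"
    using assms(4) by (intro continuous_intros continuous_on_subset[OF regular_profile_continuous(2)[OF assms(1)]]) auto
  fix s assume "a < s" "s < b"
  then have "s > 0" using assms by auto
  then show "\<exists>y. ((\<lambda>s. s ^ (N - 1) * v' s) has_real_derivative y) (at s) \<and> y \<le> 0"
    using assms(2,3) by (intro exI[of _ "- (s ^ (N - 1) * f (v s))"] conjI flux_DERIV regular_profile_DERIV(2)[OF assms(1)]) auto
qed

lemma regular_profile_decreasing:
  assumes v: "regular_profile N f v v'" "N \<ge> 2" "\<And>s. s > 0 \<Longrightarrow> f (v s) \<ge> 0"
  shows "r \<ge> 0 \<Longrightarrow> v' r \<le> 0" and "0 \<le> a \<Longrightarrow> a \<le> b \<Longrightarrow> v b \<le> v a"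
proof -
  show neg: "v' r \<le> 0" if "r \<ge> 0" for r
  proof (cases "r = 0")
    case True then show ?thesis using v by (simp add: regular_profile_def)
  next
    case False
    have "r ^ (N - 1) * v' r \<le> 0 ^ (N - 1) * v' 0" using flux_antimono[OF v(1) _ v(3)] v(2) that by simp
    also have "\<dots> = 0" using v(2) by simp
    finally show ?thesis using zero_less_power[of r "N - 1"] False that
      by (metis less_le mult_pos_pos not_le)
  qed
  show "v b \<le> v a" if "0 \<le> a" "a \<le> b"
  proof (rule DERIV_nonpos_imp_decreasing_open[OF that(2)])
    show "continuous_on {a..b} v"
      using that by (intro continuous_on_subset[OF regular_profile_continuous(1)[OF v(1)]]) auto
    show "\<exists>y. (v has_real_derivative y) (at x) \<and> y \<le> 0" if "a < x" for x
      using that \<open>0 \<le> a\<close> regular_profile_DERIV(1)[OF v(1)] neg[of x] by (intro exI[of _ "v' x"]) auto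
  qed
qed

text \<open>Since v (2 r) \<ge> 0, the mean slope on [r, 2 r] is at most v r / r in size, and it is
  attained at some \<xi>. Monotonicity of the flux carries this back to r at the price of
  (\<xi>/r)^(N-1) \<le> 2^(N-1). The bound sees the profile only through v r.\<close>

lemma regular_profile_derivative_bound:
  assumes v: "regular_profile N f v v'" "N \<ge> 2" "\<And>s. s > 0 \<Longrightarrow> f (v s) \<ge> 0"
    and pos: "\<And>s. s > 0 \<Longrightarrow> v s \<ge> 0" and r: "r > 0"
  shows "- v' r \<le> 2 ^ (N - 1) * v r / r"
proof -
  obtain \<xi> where xi: "r < \<xi>" "\<xi> < 2 * r" "v (2 * r) - v r = (2 * r - r) * v' \<xi>"
    using MVT2[of r "2 * r" v v'] regular_profile_DERIV(1)[OF v(1)] r by force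
  have "r ^ (N - 1) * (- v' r) \<le> \<xi> ^ (N - 1) * (- v' \<xi>)"
    using flux_antimono[OF v(1) _ v(3), of r \<xi>] xi r v(2) by simp
  also have "\<dots> \<le> (2 * r) ^ (N - 1) * (- v' \<xi>)"
    using xi r regular_profile_decreasing(1)[OF v, of \<xi>] by (intro mult_right_mono power_mono) auto
  finally have "r ^ (N - 1) * (- v' r) \<le> r ^ (N - 1) * (2 ^ (N - 1) * (- v' \<xi>))"
    by (simp add: power_mult_distrib mult_ac)
  then have "- v' r \<le> 2 ^ (N - 1) * (- v' \<xi>)"
    by (rule mult_left_le_imp_le) (use r in auto)
  also have "- v' \<xi> = (v r - v (2 * r)) / r" using xi(3) r by (simp add: field_simps)
  also have "2 ^ (N - 1) * ((v r - v (2 * r)) / r) \<le> 2 ^ (N - 1) * (v r / r)"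
    using pos[of "2 * r"] r by (intro mult_left_mono divide_right_mono) auto
  finally show ?thesis by simp
qed

text \<open>In the derivative of s^(N-1) v' + f(v) s^N / N the terms with f(v) cancel; f'(v) v' s^N
  / N remains, and it is nonpositive because v decreases.\<close>

lemma regular_profile_flux_bound:
  assumes v: "regular_profile N f v v'" "N \<ge> 2" and pos: "\<And>s. s > 0 \<Longrightarrow> f (v s) \<ge> 0"
    and f: "\<And>x. (f has_real_derivative f' x) (at x)" "\<And>x. f' x \<ge> 0" and r: "r > 0"
  shows "v' r \<le> - f (v r) * r / real N"
proof -
  let ?h = "\<lambda>s. s ^ (N - 1) * v' s + f (v s) * s ^ N / real N"
  have cf: "continuous_on UNIV f" using f(1) DERIV_isCont continuous_at_imp_continuous_on by blast
  have "?h r \<le> ?h 0"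
  proof (rule DERIV_nonpos_imp_decreasing_open[where f = ?h])
    show "continuous_on {0..r} ?h"
      by (intro continuous_intros continuous_on_compose2[OF cf]
        continuous_on_subset[OF regular_profile_continuous(1)[OF v(1)]]
        continuous_on_subset[OF regular_profile_continuous(2)[OF v(1)]]) (use v(2) in auto)
    fix s :: real assume s: "0 < s" "s < r"
    have 1: "((\<lambda>s. s ^ (N - 1) * v' s) has_real_derivative - (s ^ (N - 1) * f (v s))) (at s)"
      using v(2) s by (intro flux_DERIV regular_profile_DERIV(2)[OF v(1)]) auto
    have 2: "((\<lambda>s. f (v s)) has_real_derivative f' (v s) * v' s) (at s)"
      by (rule DERIV_chain2[OF f(1) regular_profile_DERIV(1)[OF v(1) s(1)]])
    have 3: "((\<lambda>s. s ^ N) has_real_derivative real N * s ^ (N - 1)) (at s)"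
      using DERIV_pow[of N s] by simp
    have "(?h has_real_derivative f' (v s) * v' s * s ^ N / real N) (at s)"
      by (rule DERIV_cong[OF DERIV_add[OF 1 DERIV_cdivide[OF DERIV_mult[OF 2 3]]]])
         (use v(2) in \<open>simp add: field_simps\<close>)
    moreover have "f' (v s) * v' s * s ^ N / real N \<le> 0"
      using f(2)[of "v s"] regular_profile_decreasing(1)[OF v pos, of s] s
      by (simp add: divide_le_0_iff mult_nonneg_nonpos mult_nonpos_nonneg)
    ultimately show "\<exists>y. (?h has_real_derivative y) (at s) \<and> y \<le> 0" by blast
  qed (use r in simp)
  also have "?h 0 = 0" using v(2) by (simp add: power_0_left)
  finally have "r ^ (N - 1) * v' r \<le> r ^ (N - 1) * (- f (v r) * r / real N)"
    using v(2) by (cases N) (simp_all add: mult_ac)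
  then show ?thesis by (rule mult_left_le_imp_le) (use r in auto)
qed

text \<open>M is chosen so that G M lies within r^2/(2N) of the supremum L of G. A profile still
  above M at radius r would have G (v 0) \<ge> G (v r) + r^2/(2N) > L. M is fixed before the
  profile, which is the uniformity in the central value.\<close>

lemma uniform_upper_bound:
  assumes f: "\<And>x. (f has_real_derivative f' x) (at x)" "\<And>x. f' x \<ge> 0" "\<And>x. x > 0 \<Longrightarrow> f x > 0"
    and F: "(\<integral>\<^sup>+ s\<in>{1..}. ennreal (1 / f s) \<partial>lborel) < \<infinity>"
    and N: "N \<ge> 2" and r: "r > 0"
  obtains M where "M > 0" "\<And>v v'. regular_profile N f v v' \<Longrightarrow> (\<And>s. s \<ge> 0 \<Longrightarrow> v s > 0) \<Longrightarrow> v r \<le> M"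
proof -
  define G where "G x = integral {1..x} (\<lambda>s. 1 / f s)" for x
  have cf: "continuous_on {1..x} (\<lambda>s. 1 / f s)" for x
    using f(3) f(1)[THEN DERIV_isCont]
    by (intro continuous_intros continuous_at_imp_continuous_on) (auto simp: less_le intro: f(3)[THEN less_imp_neq, symmetric])
  have dG: "(G has_real_derivative 1 / f x) (at x)" if "x > 1" for x
  proof -
    have "(G has_real_derivative 1 / f x) (at x within {1..x + 1})"
      unfolding G_def using integral_has_real_derivative[OF cf[of "x + 1"], of x] that by simp
    then show ?thesis using that at_within_interior[of x "{1..x + 1}"] by (simp add: interior_atLeastAtMost_real)
  qed
  obtain B where B: "\<And>x. G x \<le> B"
  proof -
    let ?B = "enn2real (\<integral>\<^sup>+ s\<in>{1..}. ennreal (1 / f s) \<partial>lborel)"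
    have "G x \<le> ?B" for x
    proof -
      have int: "set_integrable lborel {1..x} (\<lambda>s. 1 / f s)" by (rule borel_integrable_atLeastAtMost'[OF cf])
      have nn: "f s > 0" if "s \<ge> 1" for s using f(3)[of s] that by auto
      have "G x = (LINT s:{1..x}|lborel. 1 / f s)"
        unfolding G_def using int by (simp add: set_borel_integral_eq_integral)
      also have "ennreal \<dots> = (\<integral>\<^sup>+ s. ennreal (indicator {1..x} s *\<^sub>R (1 / f s)) \<partial>lborel)"
        unfolding set_lebesgue_integral_def
        using int[unfolded set_integrable_def] nn
        by (intro nn_integral_eq_integral[symmetric]) (auto simp: indicator_def less_imp_le)
      also have "\<dots> \<le> (\<integral>\<^sup>+ s\<in>{1..}. ennreal (1 / f s) \<partial>lborel)"
        by (intro nn_integral_mono) (auto simp: indicator_def)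
      finally have "enn2real (ennreal (G x)) \<le> ?B" using F by (intro enn2real_mono) auto
      then show ?thesis by (smt (verit) enn2real_ennreal enn2real_nonneg)
    qed
    then show thesis using that by blast
  qed
  define L where "L = (SUP x. G x)"
  have bdd: "bdd_above (range G)" using B by (intro bdd_aboveI2[of _ _ B])
  have "L - r\<^sup>2 / (2 * real N) < L" using r N by simp
  then obtain x0 where x0: "L - r\<^sup>2 / (2 * real N) < G x0"
    unfolding L_def by (subst (asm) less_cSUP_iff) (use bdd in auto)
  \<comment> \<open>The floor 2 keeps the profile above 1 on [0,r], where G is differentiable; below
    1 the defining interval is empty and G is 0.\<close>
  define M where "M = max x0 2"
  have mono: "G a \<le> G b" if "a \<le> b" for a b
    unfolding G_def using that f(3)
    by (intro integral_subset_le integrable_continuous_interval cf) (auto intro!: less_imp_le f(3))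
  have GM: "L - r\<^sup>2 / (2 * real N) < G M" using x0 mono[of x0 M] by (simp add: M_def)
  have "v r \<le> M" if v: "regular_profile N f v v'" "\<And>s. s \<ge> 0 \<Longrightarrow> v s > 0" for v v'
  proof (rule ccontr)
    assume "\<not> v r \<le> M"
    have fv: "f (v s) \<ge> 0" if "s > 0" for s using f(3) v(2)[of s] that by (simp add: less_imp_le)
    have big: "v s > M" if "0 \<le> s" "s \<le> r" for s
      using regular_profile_decreasing(2)[OF v(1) N fv that] \<open>\<not> v r \<le> M\<close> by simp
    \<comment> \<open>G(v) has derivative v'/f(v) \<le> -s/N, which the derivative s/N of the added
      term can at most balance.\<close>
    let ?h = "\<lambda>s. G (v s) + s\<^sup>2 / (2 * real N)"
    have "?h r \<le> ?h 0"
    proof (rule DERIV_nonpos_imp_decreasing_open[where f = ?h])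
      have "continuous_on {M<..} G"
        by (intro continuous_at_imp_continuous_on ballI DERIV_isCont[OF dG]) (auto simp: M_def)
      moreover have "continuous_on {0..r} v"
        by (rule continuous_on_subset[OF regular_profile_continuous(1)[OF v(1)]]) auto
      ultimately have "continuous_on {0..r} (\<lambda>s. G (v s))"
        by (rule continuous_on_compose2) (use big in auto)
      then show "continuous_on {0..r} ?h"
        by (intro continuous_on_add continuous_intros) (use N in auto)
      fix s :: real assume s: "0 < s" "s < r"
      have vs: "v s > 1" using big[of s] s by (simp add: M_def)
      have "(?h has_real_derivative 1 / f (v s) * v' s + s / real N) (at s)"
        by (rule DERIV_cong[OF DERIV_add[OF DERIV_chain2[OF dG[OF vs] regular_profile_DERIV(1)[OF v(1) s(1)]]
              DERIV_cdivide[OF DERIV_power[OF DERIV_ident]]]]) (use N in \<open>simp add: field_simps\<close>)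
      moreover have "1 / f (v s) * v' s + s / real N \<le> 0"
      proof -
        have "f (v s) > 0" using vs f(3)[of "v s"] by simp
        moreover have "v' s \<le> - f (v s) * s / real N"
          by (rule regular_profile_flux_bound[OF v(1) N fv f(1,2) s(1)])
        ultimately have "v' s / f (v s) \<le> (- f (v s) * s / real N) / f (v s)"
          by (intro divide_right_mono) auto
        then show ?thesis using \<open>f (v s) > 0\<close> by simp
      qed
      ultimately show "\<exists>y. (?h has_real_derivative y) (at s) \<and> y \<le> 0" by blast
    qed (use r in simp)
    then have "G (v r) + r\<^sup>2 / (2 * real N) \<le> G (v 0)" by simp
    also have "\<dots> \<le> L" unfolding L_def by (intro cSUP_upper bdd) auto
    finally have "G (v r) < G M" using GM by simp
    moreover have "G M \<le> G (v r)" using big[of r] r by (intro mono) auto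
    ultimately show False by simp
  qed
  then show thesis using that[of M] by (auto simp: M_def)
qed

section \<open>Monotone limits and differentiation under a pointwise limit\<close>

lemma bounded_mono_tendsto_at_top:
  fixes g :: "real \<Rightarrow> real"
  assumes mono: "\<And>x y. 0 < x \<Longrightarrow> x \<le> y \<Longrightarrow> g x \<le> g y" and B: "\<And>x. 0 < x \<Longrightarrow> g x \<le> B"
  obtains L where "(g \<longlongrightarrow> L) at_top" "\<And>x. 0 < x \<Longrightarrow> g x \<le> L"
proof -
  let ?L = "SUP x\<in>{0<..}. g x"
  have bdd: "bdd_above (g ` {0<..})" using B by (intro bdd_aboveI2[of _ _ B]) auto
  have up: "g x \<le> ?L" if "0 < x" for x using that by (intro cSUP_upper bdd) auto
  have "(g \<longlongrightarrow> ?L) at_top"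
  proof (rule order_tendstoI)
    fix a assume "a < ?L"
    then obtain x where x: "x > 0" "a < g x"
      by (subst (asm) less_cSUP_iff) (use bdd in auto)
    then show "\<forall>\<^sub>F y in at_top. a < g y"
      by (intro eventually_mono[OF eventually_ge_at_top[of x]]) (auto dest: mono[of x])
  next
    fix a assume "?L < a"
    then show "\<forall>\<^sub>F y in at_top. g y < a"
      by (intro eventually_mono[OF eventually_gt_at_top[of 0]]) (auto dest: up)
  qed
  then show thesis using up by (rule that)
qed

text \<open>A common bound on g'' gives a first-order Taylor remainder of at most L |y - x|^2 with
  the same L for all indices. Such an inequality survives pointwise limits and yields the derivative
  of G.\<close>

lemma DERIV_pointwise_limit:
  fixes g g' g'' :: "'i \<Rightarrow> real \<Rightarrow> real"
  assumes S: "open S" "convex S" and F: "F \<noteq> bot"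
    and D: "\<forall>\<^sub>F i in F. \<forall>x\<in>S. (g i has_real_derivative g' i x) (at x) \<and>
               (g' i has_real_derivative g'' i x) (at x) \<and> \<bar>g'' i x\<bar> \<le> L"
    and lim: "\<And>x. x \<in> S \<Longrightarrow> ((\<lambda>i. g i x) \<longlongrightarrow> G x) F" "\<And>x. x \<in> S \<Longrightarrow> ((\<lambda>i. g' i x) \<longlongrightarrow> H x) F"
    and x: "x \<in> S"
  shows "(G has_real_derivative H x) (at x)"
proof -
  have est: "\<bar>G y - G x - H x * (y - x)\<bar> \<le> L * \<bar>y - x\<bar> * \<bar>y - x\<bar>" if y: "y \<in> S" for y
  proof (rule tendsto_upperbound[OF _ _ F])
    show "((\<lambda>i. \<bar>g i y - g i x - g' i x * (y - x)\<bar>) \<longlongrightarrow> \<bar>G y - G x - H x * (y - x)\<bar>) F"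
      by (intro tendsto_intros lim x y)
    show "\<forall>\<^sub>F i in F. \<bar>g i y - g i x - g' i x * (y - x)\<bar> \<le> L * \<bar>y - x\<bar> * \<bar>y - x\<bar>"
      using D
    proof eventually_elim
      case (elim i)
      let ?h = "\<lambda>z. g i z - g' i x * (z - x)"
      have seg: "closed_segment x y \<subseteq> S" using S(2) x y by (simp add: closed_segment_subset)
      have D1: "(g' i has_real_derivative g'' i z) (at z within S)" if "z \<in> S" for z
        by (rule has_field_derivative_at_within) (use elim that in blast)
      have D2: "norm (g'' i z) \<le> L" if "z \<in> S" for z using elim that by simp
      from D2[OF x] have L0: "L \<ge> 0" by (metis norm_ge_zero order_trans)
      have "norm (?h y - ?h x) \<le> (L * \<bar>y - x\<bar>) * norm (y - x)"
      \<comment> \<open>The mean value bound is used twice: for g', which is L-Lipschitz, and then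
        for the remainder \<open>?h\<close>, whose derivative is g'(z) - g'(x).\<close>
      proof (rule field_differentiable_bound[of "closed_segment x y" ?h "\<lambda>z. g' i z - g' i x"])
        fix z assume z: "z \<in> closed_segment x y"
        then have zS: "z \<in> S" using seg by auto
        have "(?h has_real_derivative (g' i z - g' i x * 1)) (at z)"
          using elim zS by (intro DERIV_diff DERIV_cmult) (auto intro!: derivative_eq_intros)
        then show "(?h has_real_derivative (g' i z - g' i x)) (at z within closed_segment x y)"
          using has_field_derivative_at_within by fastforce
        have "norm (g' i z - g' i x) \<le> L * norm (z - x)"
          by (rule field_differentiable_bound[OF S(2) D1 D2 zS x])
        also have "\<dots> \<le> L * \<bar>y - x\<bar>"
          using segment_bound1[OF z] L0 by (intro mult_left_mono) auto
        finally show "norm (g' i z - g' i x) \<le> L * \<bar>y - x\<bar>" .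
      qed auto
      then show ?case by (simp add: algebra_simps)
    qed
  qed
  have "((\<lambda>y. (G y - G x) / (y - x) - H x) \<longlongrightarrow> 0) (at x)"
  proof (rule Lim_null_comparison)
    show "((\<lambda>y. L * \<bar>y - x\<bar>) \<longlongrightarrow> 0) (at x)" by (auto intro!: tendsto_eq_intros)
    have "\<forall>\<^sub>F y in at x. y \<in> S \<and> y \<noteq> x"
      using eventually_at_in_open[OF S(1) x] by (simp add: eventually_at_filter)
    then show "\<forall>\<^sub>F y in at x. norm ((G y - G x) / (y - x) - H x) \<le> L * \<bar>y - x\<bar>"
    proof eventually_elim
      case (elim y)
      then have "(G y - G x) / (y - x) - H x = (G y - G x - H x * (y - x)) / (y - x)"
        by (simp add: diff_divide_distrib)
      then show ?case using est[of y] elim by (simp add: abs_divide divide_le_eq)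
    qed
  qed
  then show ?thesis by (simp add: has_field_derivative_iff LIM_zero_iff)
qed

lemma radial_solutionI:
  assumes v: "\<And>r. r > 0 \<Longrightarrow> (v has_real_derivative q r) (at r)"
    and q: "\<And>r. r > 0 \<Longrightarrow> (q has_real_derivative - (real N - 1) / r * q r - f (v r)) (at r)"
    and f: "continuous_on UNIV f"
  shows "radial_solution N f v"
proof -
  have d: "deriv v r = q r" if "r > 0" for r using v[OF that] by (rule DERIV_imp_deriv)
  have dq: "(deriv v has_real_derivative - (real N - 1) / r * q r - f (v r)) (at r)" if "r > 0" for r
    by (rule has_field_derivative_transform_within_open[OF q[OF that], where S = "{0<..}"])
       (use that d in auto)
  have dd: "deriv (deriv v) r = - (real N - 1) / r * q r - f (v r)" if "r > 0" for r
    using dq[OF that] by (rule DERIV_imp_deriv)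
  have "continuous_on {0<..} v" "continuous_on {0<..} q"
    using v q by (auto intro!: continuous_at_imp_continuous_on intro: DERIV_isCont)
  then have "continuous_on {0<..} (\<lambda>r. - (real N - 1) / r * q r - f (v r))"
    by (intro continuous_intros continuous_on_compose2[OF f]) auto
  then have "continuous_on {0<..} (deriv (deriv v))"
    by (rule continuous_on_eq) (auto simp: dd)
  then show ?thesis
    using v dq dd d by (auto simp: radial_solution_def C2_on_def real_differentiable_def algebra_simps diff_divide_distrib)
qed

text \<open>The difference of the two fluxes starts at 0 and has nonpositive derivative. For ordered
  solutions this makes u' monotone in the central value, so u' converges as well as u.\<close>

lemma regular_profile_derivative_mono:
  assumes v: "regular_profile N f v v'" and z: "regular_profile N f z z'" and N: "N \<ge> 2"
    and le: "\<And>s. s > 0 \<Longrightarrow> f (z s) \<le> f (v s)" and r: "r > 0"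
  shows "v' r \<le> z' r"
proof -
  let ?P = "\<lambda>s. s ^ (N - 1) * v' s - s ^ (N - 1) * z' s"
  have "?P r \<le> ?P 0"
  proof (rule DERIV_nonpos_imp_decreasing_open[where f = ?P])
    show "continuous_on {0..r} ?P"
      by (intro continuous_intros continuous_on_subset[OF regular_profile_continuous(2)[OF v]]
          continuous_on_subset[OF regular_profile_continuous(2)[OF z]]) auto
    fix s :: real assume s: "0 < s" "s < r"
    have "(?P has_real_derivative - (s ^ (N - 1) * f (v s)) - - (s ^ (N - 1) * f (z s))) (at s)"
      using N s by (intro DERIV_diff flux_DERIV regular_profile_DERIV(2)[OF v] regular_profile_DERIV(2)[OF z]) auto
    moreover have "s ^ (N - 1) * f (z s) \<le> s ^ (N - 1) * f (v s)"
      using s le by (intro mult_left_mono) auto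
    ultimately show "\<exists>y. (?P has_real_derivative y) (at s) \<and> y \<le> 0"
      by (intro exI conjI) auto
  qed (use r in simp)
  also have "?P 0 = 0" using N by (simp add: power_0_left)
  finally have "r ^ (N - 1) * v' r \<le> r ^ (N - 1) * z' r" by simp
  then show ?thesis by (rule mult_left_le_imp_le) (use r in auto)
qed

section \<open>Stability form in the limit, and a cut-off function\<close>

lemma C1_0_continuous:
  assumes "\<phi> \<in> C1_0" shows "continuous_on UNIV \<phi>"
  using assms by (auto simp: C1_0_def C1_def intro!: continuous_at_imp_continuous_on differentiable_imp_continuous_within)

lemma grad_outside_support:
  assumes "x \<notin> closure {x. \<phi> x \<noteq> 0}" shows "grad \<phi> x = 0"
proof (rule grad_unique)
  have "((\<lambda>x. 0) has_derivative (\<lambda>h. 0 \<bullet> h)) (at x)" by simp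
  then show "(\<phi> has_derivative (\<lambda>h. 0 \<bullet> h)) (at x)"
    by (rule has_derivative_transform_within_open[where s = "- closure {x. \<phi> x \<noteq> 0}"])
       (use assms closure_subset[of "{x. \<phi> x \<noteq> 0}"] in auto)
qed

lemma integrable_C1_0:
  fixes \<phi> :: "'a::euclidean_space \<Rightarrow> real"
  assumes \<phi>: "\<phi> \<in> C1_0"
  shows "integrable lborel (\<lambda>x. (norm (grad \<phi> x))\<^sup>2)"
    and "continuous_on UNIV g \<Longrightarrow> integrable lborel (\<lambda>x. g x * (\<phi> x)\<^sup>2)"
proof -
  let ?K = "closure {x. \<phi> x \<noteq> 0}"
  have K: "compact ?K" and cg: "continuous_on UNIV (grad \<phi>)" using \<phi> by (auto simp: C1_0_def C1_def)
  have "integrable lborel (\<lambda>x. indicator ?K x *\<^sub>R (norm (grad \<phi> x))\<^sup>2)"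
    by (intro borel_integrable_compact K continuous_intros continuous_on_subset[OF cg]) auto
  then show "integrable lborel (\<lambda>x. (norm (grad \<phi> x))\<^sup>2)"
    by (rule Bochner_Integration.integrable_cong[THEN iffD1, rotated -1])
       (auto simp: indicator_def grad_outside_support)
  assume "continuous_on UNIV g"
  then have "integrable lborel (\<lambda>x. indicator ?K x *\<^sub>R (g x * (\<phi> x)\<^sup>2))"
    using C1_0_continuous[OF \<phi>]
    by (intro borel_integrable_compact K continuous_intros) (auto intro: continuous_on_subset)
  then show "integrable lborel (\<lambda>x. g x * (\<phi> x)\<^sup>2)"
    by (rule Bochner_Integration.integrable_cong[THEN iffD1, rotated -1])
       (use closure_subset[of "{x. \<phi> x \<noteq> 0}"] in \<open>auto simp: indicator_def\<close>)
qed

text \<open>Stability of U k bounds the potential term by the Dirichlet energy E of \<phi>, which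
  does not depend on k, so Fatou's lemma passes the bound to V. Integrability comes first: only then
  may the integral in \<open>stability_form\<close> be split, a Bochner integral being 0 by default
  otherwise.\<close>

lemma stability_form_limit:
  fixes V :: "'a::euclidean_space \<Rightarrow> real" and U :: "nat \<Rightarrow> 'a \<Rightarrow> real"
  assumes f': "continuous_on UNIV (deriv f)" "\<And>s. deriv f s \<ge> 0"
    and U: "\<And>k. continuous_on UNIV (U k)" "\<And>k. stability_form f (U k) \<phi> \<ge> 0"
    and V: "(\<lambda>x. deriv f (V x)) \<in> borel_measurable borel"
    and lim: "AE x in lborel. (\<lambda>k. U k x) \<longlonglongrightarrow> V x"
    and \<phi>: "\<phi> \<in> C1_0"
  shows "integrable lborel (\<lambda>x. deriv f (V x) * (\<phi> x)\<^sup>2)" and "stability_form f V \<phi> \<ge> 0"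
proof -
  define E where "E = (\<integral>x. (norm (grad \<phi> x))\<^sup>2 \<partial>lborel)"
  note ig = integrable_C1_0(1)[OF \<phi>]
  have E0: "E \<ge> 0" unfolding E_def by (intro integral_nonneg_AE) auto
  have m\<phi>: "\<phi> \<in> borel_measurable borel"
    using C1_0_continuous[OF \<phi>] by (rule borel_measurable_continuous_onI)
  have cU: "continuous_on UNIV (\<lambda>x. deriv f (U k x))" for k
    by (rule continuous_on_compose2[OF f'(1) U(1)]) auto
  have le: "(\<integral>\<^sup>+x. ennreal (deriv f (U k x) * (\<phi> x)\<^sup>2) \<partial>lborel) \<le> ennreal E" for k
  proof -
    note iU = integrable_C1_0(2)[OF \<phi> cU[of k]]
    have "stability_form f (U k) \<phi> = E - (\<integral>x. deriv f (U k x) * (\<phi> x)\<^sup>2 \<partial>lborel)"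
      unfolding stability_form_def E_def by (rule Bochner_Integration.integral_diff[OF ig iU])
    with U(2)[of k] have "(\<integral>x. deriv f (U k x) * (\<phi> x)\<^sup>2 \<partial>lborel) \<le> E" by simp
    then show ?thesis
      by (subst nn_integral_eq_integral[OF iU]) (auto simp: f'(2) intro: ennreal_leI)
  qed
  have mU: "(\<lambda>x. deriv f (U k x)) \<in> borel_measurable borel" for k
    using cU by (rule borel_measurable_continuous_onI)
  have "(\<integral>\<^sup>+x. ennreal (deriv f (V x) * (\<phi> x)\<^sup>2) \<partial>lborel)
      = (\<integral>\<^sup>+x. liminf (\<lambda>k. ennreal (deriv f (U k x) * (\<phi> x)\<^sup>2)) \<partial>lborel)"
  proof (rule nn_integral_cong_AE)
    show "AE x in lborel. ennreal (deriv f (V x) * (\<phi> x)\<^sup>2) = liminf (\<lambda>k. ennreal (deriv f (U k x) * (\<phi> x)\<^sup>2))"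
      using lim
    proof eventually_elim
      case (elim x)
      have "(\<lambda>k. deriv f (U k x)) \<longlonglongrightarrow> deriv f (V x)"
        by (rule continuous_on_tendsto_compose[OF f'(1) elim]) auto
      then have "(\<lambda>k. ennreal (deriv f (U k x) * (\<phi> x)\<^sup>2)) \<longlonglongrightarrow> ennreal (deriv f (V x) * (\<phi> x)\<^sup>2)"
        by (intro tendsto_ennrealI tendsto_intros)
      then show ?case by (intro lim_imp_Liminf[symmetric]) auto
    qed
  qed
  also have "\<dots> \<le> liminf (\<lambda>k. \<integral>\<^sup>+x. ennreal (deriv f (U k x) * (\<phi> x)\<^sup>2) \<partial>lborel)"
    by (rule nn_integral_liminf) (use mU m\<phi> in measurable)
  also have "\<dots> \<le> liminf (\<lambda>k. ennreal E)" by (intro Liminf_mono always_eventually allI le)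
  also have "\<dots> = ennreal E" by (simp add: Liminf_const)
  finally have fin: "(\<integral>\<^sup>+x. ennreal (deriv f (V x) * (\<phi> x)\<^sup>2) \<partial>lborel) \<le> ennreal E" .
  show iV: "integrable lborel (\<lambda>x. deriv f (V x) * (\<phi> x)\<^sup>2)"
    by (rule integrableI_nonneg)
       (use V m\<phi> f'(2) fin in \<open>auto intro!: borel_measurable_times simp: top_unique less_top[symmetric]\<close>)
  have "ennreal (\<integral>x. deriv f (V x) * (\<phi> x)\<^sup>2 \<partial>lborel) \<le> ennreal E"
    using fin by (subst nn_integral_eq_integral[OF iV, symmetric]) (auto simp: f'(2))
  then have "(\<integral>x. deriv f (V x) * (\<phi> x)\<^sup>2 \<partial>lborel) \<le> E" using E0 by simp
  then show "stability_form f V \<phi> \<ge> 0"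
    unfolding stability_form_def by (simp add: Bochner_Integration.integral_diff[OF ig iV] E_def)
qed

text \<open>Squaring removes the corner of the positive part, which makes the cut-off below
  C1.\<close>

lemma DERIV_max_0_power2:
  "((\<lambda>s::real. (max 0 s)\<^sup>2) has_real_derivative 2 * max 0 s) (at s)"
proof -
  consider "s > 0" | "s = 0" | "s < 0" by linarith
  then show ?thesis
  proof cases
    case 1
    have "((\<lambda>s::real. s\<^sup>2) has_real_derivative 2 * max 0 s) (at s)"
      using 1 by (auto intro!: derivative_eq_intros)
    then show ?thesis
      by (rule has_field_derivative_transform_within_open[where S = "{0<..}"]) (use 1 in auto)
  next
    case 3
    have "((\<lambda>s::real. 0) has_real_derivative 2 * max 0 s) (at s)" using 3 by simp
    then show ?thesis
      by (rule has_field_derivative_transform_within_open[where S = "{..<0}"]) (use 3 in auto)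
  next
    case 2
    have "((\<lambda>y::real. (max 0 y)\<^sup>2 / y) \<longlongrightarrow> 0) (at 0)"
    proof (rule Lim_null_comparison)
      show "((\<lambda>y::real. \<bar>y\<bar>) \<longlongrightarrow> 0) (at 0)" by (auto intro!: tendsto_eq_intros)
    qed (auto simp: max_def power2_eq_square)
    then show ?thesis by (simp add: 2 has_field_derivative_iff)
  qed
qed

text \<open>The cut-off is the squared positive part of R^2 + 1 - |x|^2. Depending on |x|^2, it has
  zero slope at the origin; the summand 1 gives the lower bound on the ball, and the support lies in
  radius |R| + 1.\<close>

lemma C1_0_ge_one:
  obtains \<phi> :: "'a::euclidean_space \<Rightarrow> real" where "\<phi> \<in> C1_0" "\<And>x. norm x \<le> R \<Longrightarrow> \<phi> x \<ge> 1"
proof -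
  let ?\<eta> = "\<lambda>r. (max 0 (R\<^sup>2 + 1 - r\<^sup>2))\<^sup>2" and ?\<eta>' = "\<lambda>r. 2 * max 0 (R\<^sup>2 + 1 - r\<^sup>2) * (- 2 * r)"
  have d: "(?\<eta> has_real_derivative ?\<eta>' r) (at r)" for r
    by (rule DERIV_chain2[OF DERIV_max_0_power2]) (auto intro!: derivative_eq_intros)
  have "(\<lambda>x::'a. ?\<eta> (norm x)) \<in> C1_0"
  proof (rule radial_in_C1_0(1)[of ?\<eta> ?\<eta>'])
    show "(?\<eta> has_real_derivative 0) (at 0 within {0..})"
      using has_field_derivative_at_within[OF d[of 0]] by simp
    show "continuous_on {0..} ?\<eta>'" by (intro continuous_intros)
    show "?\<eta> r = 0" if "r > \<bar>R\<bar> + 1" for r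
    proof -
      have "(\<bar>R\<bar> + 1)\<^sup>2 \<le> r\<^sup>2" using that by (intro power_mono) auto
      then have "R\<^sup>2 + 1 - r\<^sup>2 \<le> 0" by (simp add: power2_sum)
      then show ?thesis by simp
    qed
  qed (use d in simp_all)
  moreover have "?\<eta> (norm x) \<ge> 1" if "norm x \<le> R" for x :: 'a
  proof -
    have "(norm x)\<^sup>2 \<le> R\<^sup>2" using that by (intro power_mono) auto
    then show ?thesis by (intro one_le_power) simp
  qed
  ultimately show thesis by (rule that)
qed

section \<open>Consequences of the assumptions on f, and the limit solution\<close>

text \<open>Oddness of f makes f' even, so its sign on the positive axis carries over to the
  negative one; f' 0 \<ge> 0 follows by continuity from the right.\<close>

lemma standing_assumptions_facts:
  assumes "standing_assumptions f"
  shows "(f has_real_derivative deriv f x) (at x)" and "continuous_on UNIV (deriv f)"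
    and "deriv f x \<ge> 0" and "0 < a \<Longrightarrow> a < b \<Longrightarrow> deriv f a < deriv f b"
    and "continuous_on UNIV f" and "f 0 = 0" and "s > 0 \<Longrightarrow> f s > 0"
    and "a \<le> b \<Longrightarrow> f a \<le> f b"
    and "(\<integral>\<^sup>+ s\<in>{1..}. ennreal (1 / f s) \<partial>lborel) < \<infinity>"
proof -
  have odd: "\<And>x. f (- x) = - f x" and C2: "C2_on (- {0}) f"
    and p: "\<And>u. u > 0 \<Longrightarrow> f u > 0 \<and> deriv f u > 0 \<and> deriv (deriv f) u > 0"
    and F: "\<And>u. u > 0 \<Longrightarrow> (\<integral>\<^sup>+ s\<in>{u..}. ennreal (1 / f s) \<partial>lborel) < \<infinity>"
    using assms by (auto simp: standing_assumptions_def)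
  show D: "(f has_real_derivative deriv f x) (at x)" for x
    using assms by (auto simp: standing_assumptions_def DERIV_deriv_iff_real_differentiable)
  show c: "continuous_on UNIV (deriv f)" using assms by (auto simp: standing_assumptions_def)
  have even: "deriv f (- x) = deriv f x" for x
  proof -
    have 1: "((\<lambda>x. f (- x)) has_real_derivative deriv f (- x) * (- 1)) (at x)"
      by (rule DERIV_chain2[OF D]) (auto intro!: derivative_eq_intros)
    have 2: "((\<lambda>x. f (- x)) has_real_derivative - deriv f x) (at x)"
      unfolding odd by (rule DERIV_minus[OF D])
    show ?thesis using DERIV_unique[OF 1 2] by simp
  qed
  show nn: "deriv f x \<ge> 0" for x
  proof -
    consider "x > 0" | "x = 0" | "x < 0" by linarith
    then show ?thesis
    proof cases
      case 2
      have "(deriv f \<longlongrightarrow> deriv f 0) (at_right 0)"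
        using c by (auto simp: continuous_on_eq_continuous_at continuous_at intro: tendsto_within_subset)
      moreover have "\<forall>\<^sub>F y in at_right 0. deriv f y \<ge> 0"
        using p by (auto simp: eventually_at_filter less_imp_le)
      ultimately show ?thesis
        using 2 tendsto_lowerbound[of "deriv f" "deriv f 0" "at_right 0" 0] by simp
    next
      case 3
      then show ?thesis using p[of "- x"] even[of x] by simp
    qed (use p in \<open>auto simp: less_imp_le\<close>)
  qed
  show "deriv f a < deriv f b" if "0 < a" "a < b"
  proof (rule DERIV_pos_imp_increasing[OF that(2)])
    fix x assume "a \<le> x" "x \<le> b"
    then have "x > 0" using that by simp
    moreover have "(deriv f has_real_derivative deriv (deriv f) x) (at x)"
      using C2 \<open>x > 0\<close> by (auto simp: C2_on_def DERIV_deriv_iff_real_differentiable)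
    ultimately show "\<exists>y. (deriv f has_real_derivative y) (at x) \<and> 0 < y" using p by blast
  qed
  show "continuous_on UNIV f" using D DERIV_isCont continuous_at_imp_continuous_on by blast
  show "f 0 = 0" using odd[of 0] by simp
  show "s > 0 \<Longrightarrow> f s > 0" using p by blast
  show "a \<le> b \<Longrightarrow> f a \<le> f b" using D nn by (intro DERIV_nonneg_imp_nondecreasing[of a b f]) blast+
  show "(\<integral>\<^sup>+ s\<in>{1..}. ennreal (1 / f s) \<partial>lborel) < \<infinity>" using F by simp
qed

text \<open>As v decreases, v a \<le> M controls v on all of (a,\<infinity>). \<open>M1\<close>,
  \<open>M2\<close>, \<open>M3\<close> bound v', v'' and v''': the first by the slope estimate, the
  second by solving the equation for v'', the third by differentiating it. Monotonicity of f and f'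
  on the positive axis lets M replace v r.\<close>

lemma regular_profile_higher_derivative_bounds:
  assumes f: "standing_assumptions f" and N: "N \<ge> 2" and v: "regular_profile N f v v'"
    and pos: "\<And>s. s \<ge> 0 \<Longrightarrow> v s > 0" and a: "0 < a" and M: "v a \<le> M"
  defines "M1 \<equiv> 2 ^ (N - 1) * M / a"
  defines "M2 \<equiv> (real N - 1) / a * M1 + f M"
  defines "M3 \<equiv> (real N - 1) / a\<^sup>2 * M1 + (real N - 1) / a * M2 + deriv f M * M1"
  assumes r: "a < r"
  shows "\<bar>- (real N - 1) / r * v' r - f (v r)\<bar> \<le> M2"
    and "((\<lambda>r. - (real N - 1) / r * v' r - f (v r)) has_real_derivative
           (real N - 1) / r\<^sup>2 * v' r - (real N - 1) / r * (- (real N - 1) / r * v' r - f (v r))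
             - deriv f (v r) * v' r) (at r)"
    and "\<bar>(real N - 1) / r\<^sup>2 * v' r - (real N - 1) / r * (- (real N - 1) / r * v' r - f (v r))
             - deriv f (v r) * v' r\<bar> \<le> M3"
proof -
  note ff = standing_assumptions_facts[OF f]
  have r0: "r > 0" using a r by simp
  have fv: "f (v s) \<ge> 0" if "s > 0" for s using pos[of s] ff(7) that by (simp add: less_imp_le)
  have vr: "0 < v r" "v r \<le> M"
    using pos[of r] r0 regular_profile_decreasing(2)[OF v N fv, of a r] a r M by auto
  have "\<bar>v' r\<bar> = - v' r" using regular_profile_decreasing(1)[OF v N fv, of r] r0 by simp
  also have "\<dots> \<le> 2 ^ (N - 1) * v r / r"
    by (rule regular_profile_derivative_bound[OF v N fv _ r0]) (use pos in \<open>auto simp: less_imp_le\<close>)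
  also have "\<dots> \<le> M1"
    unfolding M1_def using vr a r by (intro frac_le mult_left_mono) auto
  finally have b1: "\<bar>v' r\<bar> \<le> M1" .
  have fM: "\<bar>f (v r)\<bar> \<le> f M" using fv[OF r0] ff(8)[OF vr(2)] by simp
  have dfM: "\<bar>deriv f (v r)\<bar> \<le> deriv f M"
    using ff(3)[of "v r"] ff(4)[OF vr(1), of M] vr(2) by (cases "v r = M") auto
  have k: "\<bar>(real N - 1) / r\<bar> \<le> (real N - 1) / a" "\<bar>(real N - 1) / r\<^sup>2\<bar> \<le> (real N - 1) / a\<^sup>2"
    using N a r by (auto simp: abs_divide intro!: frac_le power_mono)
  have abs_sub3: "\<bar>x - y - z\<bar> \<le> \<bar>x\<bar> + \<bar>y\<bar> + \<bar>z\<bar>" for x y z :: real by linarith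
  let ?w = "- (real N - 1) / r * v' r - f (v r)"
  have "\<bar>?w\<bar> \<le> \<bar>(real N - 1) / r\<bar> * \<bar>v' r\<bar> + \<bar>f (v r)\<bar>"
    unfolding abs_mult[symmetric] minus_divide_left[symmetric] mult_minus_left
    by (rule order_trans[OF abs_triangle_ineq4]) simp
  also have "\<dots> \<le> M2"
    unfolding M2_def using b1 N a by (intro add_mono mult_mono k fM) auto
  finally show b2: "\<bar>?w\<bar> \<le> M2" .
  have "((\<lambda>r. - (real N - 1) / r) has_real_derivative (real N - 1) / r\<^sup>2) (at r)"
    using r0 by (auto intro!: derivative_eq_intros simp: power2_eq_square)
  from DERIV_diff[OF DERIV_mult[OF this regular_profile_DERIV(2)[OF v r0]]
      DERIV_chain2[OF ff(1) regular_profile_DERIV(1)[OF v r0]]]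
  show "((\<lambda>r. - (real N - 1) / r * v' r - f (v r)) has_real_derivative
           (real N - 1) / r\<^sup>2 * v' r - (real N - 1) / r * ?w - deriv f (v r) * v' r) (at r)"
    by (rule DERIV_cong) (unfold minus_divide_left[symmetric], algebra)
  have "\<bar>(real N - 1) / r\<^sup>2 * v' r - (real N - 1) / r * ?w - deriv f (v r) * v' r\<bar>
      \<le> \<bar>(real N - 1) / r\<^sup>2\<bar> * \<bar>v' r\<bar> + \<bar>(real N - 1) / r\<bar> * \<bar>?w\<bar> + \<bar>deriv f (v r)\<bar> * \<bar>v' r\<bar>"
    unfolding abs_mult[symmetric] by (rule abs_sub3)
  also have "\<dots> \<le> M3"
    unfolding M3_def using b1 b2 N a dfM by (intro add_mono mult_mono k) auto
  finally show "\<bar>(real N - 1) / r\<^sup>2 * v' r - (real N - 1) / r * ?w - deriv f (v r) * v' r\<bar> \<le> M3" .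
qed

text \<open>The values converge because they increase in \<alpha> and are bounded at each radius;
  the slopes converge because they decrease and are bounded. The equation gives the limit of the
  second derivatives, and \<open>DERIV_pointwise_limit\<close> applied twice links the three
  limits.\<close>

lemma regular_profile_monotone_limit:
  fixes V V' :: "real \<Rightarrow> real \<Rightarrow> real"
  assumes f: "standing_assumptions f" and N: "N \<ge> 2"
    and V: "\<And>\<alpha>. \<alpha> > 0 \<Longrightarrow> regular_profile N f (V \<alpha>) (V' \<alpha>)"
    and pos: "\<And>\<alpha> r. \<alpha> > 0 \<Longrightarrow> r \<ge> 0 \<Longrightarrow> V \<alpha> r > 0"
    and mono: "\<And>\<alpha> \<beta> r. 0 < \<alpha> \<Longrightarrow> \<alpha> \<le> \<beta> \<Longrightarrow> r \<ge> 0 \<Longrightarrow> V \<alpha> r \<le> V \<beta> r"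
  obtains W where "radial_solution N f W"
    "\<And>r. r > 0 \<Longrightarrow> ((\<lambda>\<alpha>. V \<alpha> r) \<longlongrightarrow> W r) at_top"
    "\<And>\<alpha> r. \<alpha> > 0 \<Longrightarrow> r > 0 \<Longrightarrow> V \<alpha> r \<le> W r"
proof -
  note ff = standing_assumptions_facts[OF f]
  have fV: "f (V \<alpha> s) \<ge> 0" if "\<alpha> > 0" "s > 0" for \<alpha> s
    using pos[of \<alpha> s] ff(7) that by (simp add: less_imp_le)
  have "\<exists>M. M > 0 \<and> (\<forall>\<alpha>>0. V \<alpha> a \<le> M)" if a: "a > 0" for a
  proof -
    obtain M where "M > 0" "\<And>v v'. regular_profile N f v v' \<Longrightarrow> (\<And>s. s \<ge> 0 \<Longrightarrow> v s > 0) \<Longrightarrow> v a \<le> M"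
      using uniform_upper_bound[OF ff(1,3,7,9) N a] by blast
    then show ?thesis using V pos by blast
  qed
  then obtain M where M: "\<And>a. a > 0 \<Longrightarrow> M a > 0" "\<And>a \<alpha>. a > 0 \<Longrightarrow> \<alpha> > 0 \<Longrightarrow> V \<alpha> a \<le> M a"
    by metis
  have "\<exists>L. ((\<lambda>\<alpha>. V \<alpha> r) \<longlongrightarrow> L) at_top \<and> (\<forall>\<alpha>>0. V \<alpha> r \<le> L)" if r: "r > 0" for r
    by (rule bounded_mono_tendsto_at_top[of "\<lambda>\<alpha>. V \<alpha> r" "M r"]) (use mono M(2) r in auto)
  then obtain W where W: "\<And>r. r > 0 \<Longrightarrow> ((\<lambda>\<alpha>. V \<alpha> r) \<longlongrightarrow> W r) at_top"
     "\<And>\<alpha> r. \<alpha> > 0 \<Longrightarrow> r > 0 \<Longrightarrow> V \<alpha> r \<le> W r"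
    by metis
  have "\<exists>q. ((\<lambda>\<alpha>. V' \<alpha> r) \<longlongrightarrow> q) at_top" if r: "r > 0" for r
  proof (rule bounded_mono_tendsto_at_top[of "\<lambda>\<alpha>. - V' \<alpha> r" "2 ^ (N - 1) * M r / r"])
    fix \<alpha> \<beta> :: real assume ab: "0 < \<alpha>" "\<alpha> \<le> \<beta>"
    have "V' \<beta> r \<le> V' \<alpha> r"
      using ab mono by (intro regular_profile_derivative_mono[OF V V N _ r] ff(8)) auto
    then show "- V' \<alpha> r \<le> - V' \<beta> r" by simp
  next
    fix \<alpha> :: real assume \<alpha>: "0 < \<alpha>"
    have "- V' \<alpha> r \<le> 2 ^ (N - 1) * V \<alpha> r / r"
      by (rule regular_profile_derivative_bound[OF V N fV _ r]) (use \<alpha> pos in \<open>auto simp: less_imp_le\<close>)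
    also have "\<dots> \<le> 2 ^ (N - 1) * M r / r"
      using M(2)[OF r \<alpha>] r by (intro divide_right_mono mult_left_mono) auto
    finally show "- V' \<alpha> r \<le> 2 ^ (N - 1) * M r / r" .
  next
    fix L assume "((\<lambda>\<alpha>. - V' \<alpha> r) \<longlongrightarrow> L) at_top"
    from tendsto_minus[OF this] show "\<exists>q. ((\<lambda>\<alpha>. V' \<alpha> r) \<longlongrightarrow> q) at_top" by auto
  qed
  then obtain q where q: "\<And>r. r > 0 \<Longrightarrow> ((\<lambda>\<alpha>. V' \<alpha> r) \<longlongrightarrow> q r) at_top" by metis
  let ?V2 = "\<lambda>\<alpha> r. - (real N - 1) / r * V' \<alpha> r - f (V \<alpha> r)"
  have lim2: "((\<lambda>\<alpha>. ?V2 \<alpha> r) \<longlongrightarrow> - (real N - 1) / r * q r - f (W r)) at_top" if "r > 0" for r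
    by (intro tendsto_intros q W(1) that continuous_on_tendsto_compose[OF ff(5)]) auto
  have "(W has_real_derivative q r) (at r)"
    and "(q has_real_derivative - (real N - 1) / r * q r - f (W r)) (at r)" if r: "r > 0" for r
  proof -
    \<comment> \<open>The derivative bounds blow up at the origin, so each r gets its own half-line
      (a,\<infinity>), an open convex set containing r on which they are uniform in
      \<alpha>.\<close>
    define a where "a = r / 2"
    have a: "a > 0" "r \<in> {a<..}" "{a<..} \<subseteq> {0<..}" using r by (auto simp: a_def)
    note B = regular_profile_higher_derivative_bounds[OF f N V pos a(1) M(2)[OF a(1)]]
    have ev: "\<forall>\<^sub>F \<alpha> in at_top. P \<alpha>" if "\<And>\<alpha>. \<alpha> > 0 \<Longrightarrow> P \<alpha>" for P :: "real \<Rightarrow> bool"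
      by (rule eventually_mono[OF eventually_gt_at_top[of 0]]) (use that in auto)
    show "(W has_real_derivative q r) (at r)"
    proof (rule DERIV_pointwise_limit[OF _ _ _ ev])
      fix \<alpha> :: real assume \<alpha>: "\<alpha> > 0"
      show "\<forall>x\<in>{a<..}. (V \<alpha> has_real_derivative V' \<alpha> x) (at x) \<and>
               (V' \<alpha> has_real_derivative ?V2 \<alpha> x) (at x) \<and>
               \<bar>?V2 \<alpha> x\<bar> \<le> (real N - 1) / a * (2 ^ (N - 1) * M a / a) + f (M a)"
        using regular_profile_DERIV[OF V[OF \<alpha>]] B(1)[OF \<alpha> \<alpha> _ \<alpha>] a(1) by force
    qed (use a W(1) q in auto)
    show "(q has_real_derivative - (real N - 1) / r * q r - f (W r)) (at r)"
    proof (rule DERIV_pointwise_limit[OF _ _ _ ev])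
      fix \<alpha> :: real assume \<alpha>: "\<alpha> > 0"
      show "\<forall>x\<in>{a<..}. (V' \<alpha> has_real_derivative ?V2 \<alpha> x) (at x) \<and>
               (?V2 \<alpha> has_real_derivative (real N - 1) / x\<^sup>2 * V' \<alpha> x - (real N - 1) / x * ?V2 \<alpha> x
                  - deriv f (V \<alpha> x) * V' \<alpha> x) (at x) \<and>
               \<bar>(real N - 1) / x\<^sup>2 * V' \<alpha> x - (real N - 1) / x * ?V2 \<alpha> x - deriv f (V \<alpha> x) * V' \<alpha> x\<bar>
                 \<le> (real N - 1) / a\<^sup>2 * (2 ^ (N - 1) * M a / a)
                   + (real N - 1) / a * ((real N - 1) / a * (2 ^ (N - 1) * M a / a) + f (M a))
                   + deriv f (M a) * (2 ^ (N - 1) * M a / a)"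
      proof (intro ballI conjI)
        fix x assume x: "x \<in> {a<..}"
        then have x': "a < x" "x > 0" using a(1) by auto
        show "(V' \<alpha> has_real_derivative ?V2 \<alpha> x) (at x)"
          by (rule regular_profile_DERIV(2)[OF V[OF \<alpha>] x'(2)])
      qed (use B(2,3)[OF \<alpha> \<alpha> _ \<alpha>] in auto)
    qed (use a q lim2 in auto)
  qed
  then have "radial_solution N f W" by (rule radial_solutionI[OF _ _ ff(5)])
  then show thesis using W by (rule that)
qed

section \<open>Assembly of the singular solution\<close>

theorem theorem1p8:
  fixes f :: "real \<Rightarrow> real"
    and u :: "real \<Rightarrow> real \<Rightarrow> real"
  assumes N: "CARD('n::finite) \<ge> 3"
    and f: "standing_assumptions f"
    and u: "\<And>\<alpha>. \<alpha> > 0 \<Longrightarrow> radial_ivp_solution CARD('n) f \<alpha> (\<lambda>r. u r \<alpha>)"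
    and stable: "\<And>\<alpha>. \<alpha> > 0 \<Longrightarrow> stable_solution f (\<lambda>x::real^'n. u (norm x) \<alpha>)"
  shows "\<exists>ustar.
           singular_radial_solution CARD('n) f ustar \<and>
           (\<forall>r>0. ustar r > 0) \<and>
           (\<lambda>x::real^'n. deriv f (ustar (norm x))) \<in> L1_loc \<and>
           (\<forall>\<phi>\<in>C1_0. stability_form f (\<lambda>x::real^'n. ustar (norm x)) \<phi> \<ge> 0) \<and>
           (\<forall>r\<ge>0. strict_mono_on {0<..} (\<lambda>\<alpha>. u r \<alpha>)) \<and>
           (\<forall>r>0. ((\<lambda>\<alpha>. u r \<alpha>) \<longlongrightarrow> ustar r) at_top)"
proof -
  let ?N = "CARD('n)"
  note ff = standing_assumptions_facts[OF f]
  have dim: "DIM(real^'n) = ?N" by simp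
  define U' where "U' \<alpha> r = (if r \<le> 0 then 0 else deriv (\<lambda>r. u r \<alpha>) r)" for \<alpha> r
  have prof: "regular_profile ?N f (\<lambda>r. u r \<alpha>) (U' \<alpha>)" if "\<alpha> > 0" for \<alpha>
    unfolding U'_def by (rule regular_profile_ivp[OF u[OF that] ff(5)]) (use N in simp)
  have u0: "u 0 \<alpha> = \<alpha>" if "\<alpha> > 0" for \<alpha>
    using u[OF that] by (simp add: radial_ivp_solution_def)
  have stab: "stability_form f (\<lambda>x::real^'n. u (norm x) \<alpha>) \<phi> \<ge> 0" if "\<alpha> > 0" "\<phi> \<in> C1_0" for \<alpha> \<phi>
    using stable that by (auto simp: stable_solution_def)
  have comparison: "z r < u r \<alpha>"
    if "\<alpha> > 0" "regular_profile ?N f z z'" "\<And>r. r \<ge> 0 \<Longrightarrow> z r \<ge> 0" "z 0 < \<alpha>" "r \<ge> 0" for \<alpha> z z' r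
    by (rule stable_profile_gt[where ?'a = "real^'n" and f = f and v = "\<lambda>r. u r \<alpha>" and v' = "U' \<alpha>" and z' = z'])
       (use ff(1-4) prof stab that u0 in auto)
  \<comment> \<open>f 0 = 0 makes zero a solution; as the lower profile in the comparison it yields
    positivity.\<close>
  have zero: "regular_profile ?N f (\<lambda>_. 0) (\<lambda>_. 0)"
    by (simp add: regular_profile_def ff(6))
  have pos: "u r \<alpha> > 0" if "\<alpha> > 0" "r \<ge> 0" for \<alpha> r
    using comparison[OF that(1) zero _ _ that(2)] that by simp
  have less: "u r \<alpha> < u r \<beta>" if "0 < \<alpha>" "\<alpha> < \<beta>" "r \<ge> 0" for \<alpha> \<beta> r
    by (rule comparison[of \<beta> "\<lambda>r. u r \<alpha>" "U' \<alpha>" r])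
       (use prof that pos u0 in \<open>auto simp: less_imp_le\<close>)
  obtain W where W: "radial_solution ?N f W"
    "\<And>r. r > 0 \<Longrightarrow> ((\<lambda>\<alpha>. u r \<alpha>) \<longlongrightarrow> W r) at_top"
    "\<And>\<alpha> r. \<alpha> > 0 \<Longrightarrow> r > 0 \<Longrightarrow> u r \<alpha> \<le> W r"
  proof (rule regular_profile_monotone_limit[OF f _ prof pos])
    show "u r \<alpha> \<le> u r \<beta>" if "0 < \<alpha>" "\<alpha> \<le> \<beta>" "r \<ge> 0" for \<alpha> \<beta> r
      using less[of \<alpha> \<beta> r] that by (cases "\<alpha> = \<beta>") auto
  qed (use N in auto)
  have sing: "filterlim W at_top (at_right 0)"
    unfolding filterlim_at_top
  proof
    fix Z :: real
    \<comment> \<open>u(0,\<alpha>) = \<alpha> > Z, so u(.,\<alpha>) exceeds Z near 0 by continuity,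
      and W lies above it.\<close>
    define \<alpha> where "\<alpha> = max Z 0 + 1"
    have \<alpha>: "\<alpha> > 0" "\<alpha> > Z" by (auto simp: \<alpha>_def)
    have "((\<lambda>r. u r \<alpha>) \<longlongrightarrow> u 0 \<alpha>) (at 0 within {0..})"
      using regular_profile_continuous(1)[OF prof[OF \<alpha>(1)]] by (auto simp: continuous_on_def)
    then have "((\<lambda>r. u r \<alpha>) \<longlongrightarrow> u 0 \<alpha>) (at_right 0)"
      by (rule tendsto_within_subset) auto
    then have "\<forall>\<^sub>F r in at_right 0. Z < u r \<alpha>"
      using \<alpha> u0 by (intro order_tendstoD(1)) auto
    moreover have "\<forall>\<^sub>F r in at_right 0. (0::real) < r" by (simp add: eventually_at_right_less)
    ultimately show "\<forall>\<^sub>F r in at_right 0. Z \<le> W r"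
      by eventually_elim (use W(3)[OF \<alpha>(1)] in force)
  qed
  have Wpos: "W r > 0" if "r > 0" for r using pos[of 1 r] W(3)[of 1 r] that by simp
  have cW: "continuous_on {0<..} W"
    using W(1) by (auto simp: radial_solution_def C2_on_def intro!: continuous_at_imp_continuous_on differentiable_imp_continuous_within)
  \<comment> \<open>W is controlled only for r > 0 and its value at 0 is arbitrary; a single
    exceptional point does not affect measurability.\<close>
  have meas: "(\<lambda>x::real^'n. deriv f (W (norm x))) \<in> borel_measurable borel"
  proof (rule borel_measurable_continuous_countable_exceptions[of "{0}"])
    show "continuous_on (- {0}) (\<lambda>x::real^'n. deriv f (W (norm x)))"
      by (intro continuous_on_compose2[OF ff(2)] continuous_on_compose2[OF cW] continuous_intros) auto
  qed simp
  \<comment> \<open>Fatou's lemma works along a sequence; \<open>Suc\<close> keeps its central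
    values positive.\<close>
  have cu: "continuous_on UNIV (\<lambda>x::real^'n. u (norm x) (real (Suc k)))" for k
    by (rule continuous_on_compose2[OF regular_profile_continuous(1)[OF prof]]) (auto intro: continuous_intros)
  have seq: "filterlim (\<lambda>k. real (Suc k)) at_top sequentially"
    by (rule filterlim_compose[OF filterlim_real_sequentially filterlim_Suc])
  have lim: "AE x::real^'n in lborel. (\<lambda>k. u (norm x) (real (Suc k))) \<longlonglongrightarrow> W (norm x)"
    using AE_lborel_singleton[of "0 :: real^'n"]
    by eventually_elim (use filterlim_compose[OF W(2) seq] in auto)
  have limit: "integrable lborel (\<lambda>x::real^'n. deriv f (W (norm x)) * (\<phi> x)\<^sup>2)"
    "stability_form f (\<lambda>x::real^'n. W (norm x)) \<phi> \<ge> 0" if "\<phi> \<in> C1_0" for \<phi>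
    using stability_form_limit[OF ff(2,3) cu stab[OF _ that] meas lim that] by simp_all
  have "set_integrable lborel K (\<lambda>x::real^'n. deriv f (W (norm x)))" if K: "compact K" for K
  proof -
    obtain R where R: "\<And>x. x \<in> K \<Longrightarrow> norm x \<le> R"
      using compact_imp_bounded[OF K] by (auto simp: bounded_iff)
    obtain \<phi> :: "real^'n \<Rightarrow> real" where \<phi>: "\<phi> \<in> C1_0" "\<And>x. norm x \<le> R \<Longrightarrow> \<phi> x \<ge> 1"
      by (rule C1_0_ge_one[of R]) (rule that)
    show ?thesis
      unfolding set_integrable_def
    \<comment> \<open>On K, contained in the ball of radius R, \<phi> \<ge> 1 and f' \<ge> 0, so
      f'(W) is dominated by f'(W) \<phi>^2, already known to be integrable.\<close>
    proof (rule Bochner_Integration.integrable_bound[OF limit(1)[OF \<phi>(1)]])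
      show "(\<lambda>x. indicator K x *\<^sub>R deriv f (W (norm x))) \<in> borel_measurable lborel"
        using meas K by (auto intro!: borel_measurable_scaleR borel_measurable_indicator dest: compact_imp_closed)
      have "norm (indicator K x *\<^sub>R deriv f (W (norm x))) \<le> norm (deriv f (W (norm x)) * (\<phi> x)\<^sup>2)" for x
      proof (cases "x \<in> K")
        case True
        then have "1 \<le> (\<phi> x)\<^sup>2" using \<phi>(2) R by (intro one_le_power) auto
        from mult_left_mono[OF this ff(3)[of "W (norm x)"]] show ?thesis
          using True ff(3)[of "W (norm x)"] by (simp add: abs_mult)
      qed simp
      then show "AE x in lborel. norm (indicator K x *\<^sub>R deriv f (W (norm x))) \<le> norm (deriv f (W (norm x)) * (\<phi> x)\<^sup>2)"
        by simp
    qed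
  qed
  then have "(\<lambda>x::real^'n. deriv f (W (norm x))) \<in> L1_loc" by (simp add: L1_loc_def)
  moreover have "strict_mono_on {0<..} (\<lambda>\<alpha>. u r \<alpha>)" if "r \<ge> 0" for r
    using less that by (auto intro!: strict_mono_onI)
  ultimately show ?thesis
    using W(1,2) sing Wpos limit(2) by (intro exI[of _ W]) (auto simp: singular_radial_solution_def)
qed

end
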